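(* There exist ergodic automorphisms $T_1$ of $(X_1,\mathcal{B}_1,\mu_1)$ and $T_2$ of $(X_2,\mathcal{B}_2,\mu_2)$ (standard Borel probability spaces) which are Markov quasi-similar but are not weakly isomorphic.
   Context: An automorphism of a standard Borel probability space is an invertible bi-measurable measure-preserving map. For an automorphism $T$ of $(X,\mathcal{B},\mu)$, the Koopman operator is $U_T f=f\circ T$ on $L^2(X,\mathcal{B},\mu)$. A Markov operator $\Phi:L^2(X_1,\mathcal{B}_1,\mu_1)\to L^2(X_2,\mathcal{B}_2,\mu_2)$ is a linear contraction which maps non-negative functions to non-negative functions and satisfies $\Phi\mathbf{1}=\mathbf{1}$ and $\Phi^*\mathbf{1}=\mathbf{1}$. The automorphism $T_2$ is a Markov quasi-image of $T_1$ if there is a Markov operator $\Phi:L^2(X_1,\mathcal{B}_1,\mu_1)\to L^2(X_2,\mathcal{B}_2,\mu_2)$ with dense range such that $\Phi\circ U_{T_1}=U_{T_2}\circ\Phi$. $T_1$ and $T_2$ are Markov quasi-similar if each is a Markov quasi-image of the other. $T_2$ is a factor of $T_1$ if there is a measurable map $\pi:X_1\to X_2$ with $\pi_*\mu_1=\mu_2$ and $\pi\circ T_1=T_2\circ\pi$ ($\mu_1$-a.e.). $T_1$ and $T_2$ are weakly isomorphic if each is a factor of the other. *)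

theory Defs
  imports "HOL-Probability.Probability"
begin

definition standard_borel :: "'a measure \<Rightarrow> bool" where
  "standard_borel M \<longleftrightarrow>
     (\<exists>X. topspace X = space M \<and> completely_metrizable_space X \<and> second_countable X \<and>
          sets M = sigma_sets (space M) {U. openin X U})"

definition automorphism :: "'a measure \<Rightarrow> ('a \<Rightarrow> 'a) \<Rightarrow> bool" where
  "automorphism M T \<longleftrightarrow>
     bij_betw T (space M) (space M) \<and>
     T \<in> measurable M M \<and> the_inv_into (space M) T \<in> measurable M M \<and>
     distr M M T = M"

definition ergodic :: "'a measure \<Rightarrow> ('a \<Rightarrow> 'a) \<Rightarrow> bool" where
  "ergodic M T \<longleftrightarrow>
     (\<forall>A\<in>sets M. T -` A \<inter> space M = A \<longrightarrow> measure M A = 0 \<or> measure M A = 1)"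

text \<open>
  \<open>factor_of M1 T1 M2 T2\<close> says that \<open>T2\<close>, acting on \<open>M2\<close>, is a factor of \<open>T1\<close>, acting on
  \<open>M1\<close>. The argument order of \<open>markov_quasi_image\<close> below is the same.
\<close>

definition factor_of ::
  "'a measure \<Rightarrow> ('a \<Rightarrow> 'a) \<Rightarrow> 'b measure \<Rightarrow> ('b \<Rightarrow> 'b) \<Rightarrow> bool" where
  "factor_of M1 T1 M2 T2 \<longleftrightarrow>
     (\<exists>\<pi>\<in>measurable M1 M2. distr M1 M2 \<pi> = M2 \<and> (AE x in M1. \<pi> (T1 x) = T2 (\<pi> x)))"

definition weakly_isomorphic ::
  "'a measure \<Rightarrow> ('a \<Rightarrow> 'a) \<Rightarrow> 'b measure \<Rightarrow> ('b \<Rightarrow> 'b) \<Rightarrow> bool" where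
  "weakly_isomorphic M1 T1 M2 T2 \<longleftrightarrow> factor_of M1 T1 M2 T2 \<and> factor_of M2 T2 M1 T1"

text \<open>
  Elements of the Hilbert space are represented by functions; two representatives denote the
  same element iff they agree almost everywhere. An operator between two such spaces is a map on
  representatives, and all equations between its values are required almost everywhere only.
\<close>

definition L2 :: "'a measure \<Rightarrow> ('a \<Rightarrow> complex) set" where
  "L2 M = {f \<in> borel_measurable M. integrable M (\<lambda>x. (cmod (f x))\<^sup>2)}"

definition L2_norm :: "'a measure \<Rightarrow> ('a \<Rightarrow> complex) \<Rightarrow> real" where
  "L2_norm M f = sqrt (\<integral>x. (cmod (f x))\<^sup>2 \<partial>M)"

definition L2_inner :: "'a measure \<Rightarrow> ('a \<Rightarrow> complex) \<Rightarrow> ('a \<Rightarrow> complex) \<Rightarrow> complex" where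
  "L2_inner M f g = (\<integral>x. f x * cnj (g x) \<partial>M)"

definition L2_linear_contraction ::
  "'a measure \<Rightarrow> 'b measure \<Rightarrow> (('a \<Rightarrow> complex) \<Rightarrow> ('b \<Rightarrow> complex)) \<Rightarrow> bool" where
  "L2_linear_contraction M N \<Phi> \<longleftrightarrow>
     (\<forall>f\<in>L2 M. \<Phi> f \<in> L2 N) \<and>
     (\<forall>f\<in>L2 M. \<forall>g\<in>L2 M. (AE x in M. f x = g x) \<longrightarrow> (AE y in N. \<Phi> f y = \<Phi> g y)) \<and>
     (\<forall>f\<in>L2 M. \<forall>g\<in>L2 M. AE y in N. \<Phi> (\<lambda>x. f x + g x) y = \<Phi> f y + \<Phi> g y) \<and>
     (\<forall>c. \<forall>f\<in>L2 M. AE y in N. \<Phi> (\<lambda>x. c * f x) y = c * \<Phi> f y) \<and>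
     (\<forall>f\<in>L2 M. L2_norm N (\<Phi> f) \<le> L2_norm M f)"

text \<open>
  For a linear contraction \<open>\<Phi>\<close> a function \<open>h\<close> as below exists (Riesz representation) and is
  unique up to null sets, so that \<open>SOME\<close> merely picks a representative.
\<close>

definition L2_adjoint ::
  "'a measure \<Rightarrow> 'b measure \<Rightarrow> (('a \<Rightarrow> complex) \<Rightarrow> ('b \<Rightarrow> complex))
     \<Rightarrow> (('b \<Rightarrow> complex) \<Rightarrow> ('a \<Rightarrow> complex))" where
  "L2_adjoint M N \<Phi> g =
     (SOME h. h \<in> L2 M \<and> (\<forall>f\<in>L2 M. L2_inner N (\<Phi> f) g = L2_inner M f h))"

definition L2_dense_range ::
  "'a measure \<Rightarrow> 'b measure \<Rightarrow> (('a \<Rightarrow> complex) \<Rightarrow> ('b \<Rightarrow> complex)) \<Rightarrow> bool" where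
  "L2_dense_range M N \<Phi> \<longleftrightarrow>
     (\<forall>g\<in>L2 N. \<forall>\<epsilon>>0. \<exists>f\<in>L2 M. L2_norm N (\<lambda>y. \<Phi> f y - g y) < \<epsilon>)"

definition koopman :: "('a \<Rightarrow> 'a) \<Rightarrow> ('a \<Rightarrow> complex) \<Rightarrow> ('a \<Rightarrow> complex)" where
  "koopman T f = f \<circ> T"

definition markov_operator ::
  "'a measure \<Rightarrow> 'b measure \<Rightarrow> (('a \<Rightarrow> complex) \<Rightarrow> ('b \<Rightarrow> complex)) \<Rightarrow> bool" where
  "markov_operator M N \<Phi> \<longleftrightarrow>
     L2_linear_contraction M N \<Phi> \<and>
     (\<forall>f\<in>L2 M. (AE x in M. f x \<in> \<real>\<^sub>\<ge>\<^sub>0) \<longrightarrow> (AE y in N. \<Phi> f y \<in> \<real>\<^sub>\<ge>\<^sub>0)) \<and>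
     (AE y in N. \<Phi> (\<lambda>_. 1) y = 1) \<and>
     (AE x in M. L2_adjoint M N \<Phi> (\<lambda>_. 1) x = 1)"

definition markov_quasi_image ::
  "'a measure \<Rightarrow> ('a \<Rightarrow> 'a) \<Rightarrow> 'b measure \<Rightarrow> ('b \<Rightarrow> 'b) \<Rightarrow> bool" where
  "markov_quasi_image M1 T1 M2 T2 \<longleftrightarrow>
     (\<exists>\<Phi>. markov_operator M1 M2 \<Phi> \<and> L2_dense_range M1 M2 \<Phi> \<and>
          (\<forall>f\<in>L2 M1. AE y in M2. \<Phi> (koopman T1 f) y = koopman T2 (\<Phi> f) y))"

definition markov_quasi_similar ::
  "'a measure \<Rightarrow> ('a \<Rightarrow> 'a) \<Rightarrow> 'b measure \<Rightarrow> ('b \<Rightarrow> 'b) \<Rightarrow> bool" where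
  "markov_quasi_similar M1 T1 M2 T2 \<longleftrightarrow>
     markov_quasi_image M1 T1 M2 T2 \<and> markov_quasi_image M2 T2 M1 T1"

text \<open>
  HOL has no quantification over types. Every Polish space is homeomorphic to a subspace of
  the countable power of the real line, hence every standard Borel space is isomorphic to one
  whose underlying set is a subset of the following type. Neither the underlying set nor the
  sigma-algebra of a measure on this type is prescribed.
\<close>

type_synonym point = "nat \<Rightarrow> real"

end

theory Submission
  imports Defs
begin

text \<open>
  The two systems are the Bernoulli shifts on \<open>{0, 1}\<close> with parameters \<open>1/64\<close> and \<open>1/2\<close>.
  Passing a sequence independently at each site through a stochastic kernel between two-letter
  alphabets defines a Markov operator that commutes with the shifts. It is the infinite tensor
  power of a \<open>2 \<times> 2\<close> matrix; when that matrix is invertible, every cylinder function lies in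
  the range, so the range is dense. Such a kernel exists in both directions.
  On the other hand the entropy of the first shift is smaller than \<open>log 2\<close>, so that the second
  shift is not a factor of it.
\<close>

subsection \<open>Markov operators given by a noisy map\<close>

text \<open>Density, as opposed to surjectivity, leaves the necessary room. For the two kernels used
  here, one site contracts mean-zero functions by a factor below 1, so the inverse on n sites has
  norm growing geometrically in n; no bounded inverse survives in the limit, and entropy need not be
  preserved. The operator runs against the kernel: noise that turns sequences of parameter
  \<open>b\<close> into sequences of parameter \<open>c\<close> yields a map from L2 of the latter
  to L2 of the former. Multiplying each fair bit by an independent bit of parameter 1/32 gives
  parameter 1/64; the maximum of a sparse bit and a bit of parameter 31/63 leads back. Only one
  factor relation can be refuted: by Sinai's theorem the sparse shift is a factor of the fair one.
  Entropy enters as a count of words, and 1/64 is so small that crude estimates suffice: 16 output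
  symbols have 2^16 = 65536 possibilities, against 44 * 44 = 1936 for 16 sparse input symbols
  together with the coding errors.\<close>

lemma mult_le_sum_squares:
  fixes a b :: real assumes "0 \<le> a" "0 \<le> b" shows "a * b \<le> a\<^sup>2 + b\<^sup>2"
proof -
  have "0 \<le> a * b" using assms by simp
  then show ?thesis using sum_squares_bound[of a b] by (simp add: mult.assoc)
qed

lemma add_square_le: "(a + b)\<^sup>2 \<le> 2 * a\<^sup>2 + 2 * b\<^sup>2" for a b :: real
  using sum_squares_bound[of a b] by (simp add: power2_sum)

lemma cmod_add_square_le: "(cmod (z + w))\<^sup>2 \<le> 2 * (cmod z)\<^sup>2 + 2 * (cmod w)\<^sup>2"
  by (rule order_trans[OF power_mono[OF norm_triangle_ineq] add_square_le]) auto

section \<open>Square-integrable functions and the adjoint\<close>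

lemma L2_imp_integrable:
  assumes "finite_measure M" "f \<in> L2 M" shows "integrable M f"
proof -
  interpret finite_measure M by fact
  have [measurable]: "f \<in> borel_measurable M" and i: "integrable M (\<lambda>x. (cmod (f x))\<^sup>2)"
    using assms(2) by (auto simp: L2_def)
  have "cmod z \<le> 1 + (cmod z)\<^sup>2" for z
    using sum_squares_bound[of 1 "cmod z"] norm_ge_zero[of z] unfolding power_one by linarith
  then show ?thesis
    by - (rule Bochner_Integration.integrable_bound[of M "\<lambda>x. 1 + (cmod (f x))\<^sup>2"], auto simp: i)
qed

lemma L2_add:
  assumes "f \<in> L2 M" "g \<in> L2 M" shows "(\<lambda>x. f x + g x) \<in> L2 M"
proof -
  have [measurable]: "f \<in> borel_measurable M" "g \<in> borel_measurable M"
    and i: "integrable M (\<lambda>x. (cmod (f x))\<^sup>2)" "integrable M (\<lambda>x. (cmod (g x))\<^sup>2)"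
    using assms by (auto simp: L2_def)
  have "integrable M (\<lambda>x. (cmod (f x + g x))\<^sup>2)"
    by (rule Bochner_Integration.integrable_bound[of M "\<lambda>x. 2 * (cmod (f x))\<^sup>2 + 2 * (cmod (g x))\<^sup>2"])
       (auto simp: i cmod_add_square_le)
  then show ?thesis by (auto simp: L2_def)
qed

lemma L2_scale: "f \<in> L2 M \<Longrightarrow> (\<lambda>x. c * f x) \<in> L2 M"
  by (auto simp: L2_def norm_mult power_mult_distrib)

lemma L2_diff:
  assumes "f \<in> L2 M" "g \<in> L2 M" shows "(\<lambda>x. f x - g x) \<in> L2 M"
  using L2_add[OF assms(1) L2_scale[OF assms(2), of "-1"]] by simp

lemma L2_bounded:
  assumes "finite_measure M" "f \<in> borel_measurable M" "\<And>x. cmod (f x) \<le> C" shows "f \<in> L2 M"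
proof -
  interpret finite_measure M by fact
  note assms(2)[measurable]
  have "integrable M (\<lambda>x. (cmod (f x))\<^sup>2)"
    by (rule integrable_const_bound[of _ "C\<^sup>2"]) (use assms in \<open>auto intro!: power_mono AE_I2\<close>)
  then show ?thesis by (simp add: L2_def)
qed

lemma (in prob_space) norm_expectation_square_le:
  fixes f :: "'a \<Rightarrow> complex"
  assumes "f \<in> L2 M"
  shows "(cmod (expectation f))\<^sup>2 \<le> expectation (\<lambda>x. (cmod (f x))\<^sup>2)"
proof -
  have "integrable M (\<lambda>x. cmod (f x))" "integrable M (\<lambda>x. (cmod (f x))\<^sup>2)"
    using L2_imp_integrable[OF finite_measure_axioms assms] assms by (auto simp: L2_def)
  then have "0 \<le> expectation (\<lambda>x. (cmod (f x))\<^sup>2) - (expectation (\<lambda>x. cmod (f x)))\<^sup>2"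
    using variance_eq[of "\<lambda>x. cmod (f x)"] variance_positive[of "\<lambda>x. cmod (f x)"] by simp
  moreover have "(cmod (expectation f))\<^sup>2 \<le> (expectation (\<lambda>x. cmod (f x)))\<^sup>2"
    by (intro power_mono integral_norm_bound) auto
  ultimately show ?thesis by linarith
qed

lemma L2_norm_eq_0_iff:
  assumes "f \<in> L2 M" shows "(\<integral>x. (cmod (f x))\<^sup>2 \<partial>M) = 0 \<longleftrightarrow> (AE x in M. f x = 0)"
  using assms by (subst integral_nonneg_eq_0_iff_AE) (auto simp: L2_def)

lemma L2_mult_integrable:
  assumes "f \<in> L2 M" "g \<in> L2 M" shows "integrable M (\<lambda>x. f x * cnj (g x))"
proof -
  have [measurable]: "f \<in> borel_measurable M" "g \<in> borel_measurable M"
    and i: "integrable M (\<lambda>x. (cmod (f x))\<^sup>2)" "integrable M (\<lambda>x. (cmod (g x))\<^sup>2)"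
    using assms by (auto simp: L2_def)
  have [measurable]: "cnj \<in> borel_measurable borel"
    by (intro borel_measurable_continuous_onI continuous_intros)
  show ?thesis
    by (rule Bochner_Integration.integrable_bound[of M "\<lambda>x. (cmod (f x))\<^sup>2 + (cmod (g x))\<^sup>2"])
       (auto simp: i norm_mult mult_le_sum_squares)
qed

text \<open>The adjoint is given by \<open>SOME\<close>, so its value has to be pinned down: two
  candidates have the same inner products with every \<open>f\<close>, and pairing their difference
  with itself gives squared norm 0.\<close>

lemma L2_adjoint_eqI:
  assumes h: "h \<in> L2 M" "\<And>f. f \<in> L2 M \<Longrightarrow> L2_inner N (\<Phi> f) g = L2_inner M f h"
  shows "AE x in M. L2_adjoint M N \<Phi> g x = h x"
proof -
  define k where "k = L2_adjoint M N \<Phi> g"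
  have "k \<in> L2 M \<and> (\<forall>f\<in>L2 M. L2_inner N (\<Phi> f) g = L2_inner M f k)"
    unfolding k_def L2_adjoint_def by (rule someI[of _ h]) (use h in blast)
  then have k: "k \<in> L2 M" "\<And>f. f \<in> L2 M \<Longrightarrow> L2_inner N (\<Phi> f) g = L2_inner M f k" by blast+
  define d where "d = (\<lambda>x. k x - h x)"
  have d: "d \<in> L2 M" unfolding d_def using k(1) h(1) by (rule L2_diff)
  have "L2_inner M d k = L2_inner M d h" using h(2)[OF d] k(2)[OF d] by simp
  moreover have "(\<integral>x. d x * cnj (d x) \<partial>M) = L2_inner M d k - L2_inner M d h"
    unfolding L2_inner_def
    by (subst Bochner_Integration.integral_diff[symmetric])
       (use L2_mult_integrable[OF d] k(1) h(1) in \<open>simp_all add: d_def flip: right_diff_distrib\<close>)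
  ultimately have "(\<integral>x. d x * cnj (d x) \<partial>M) = 0" by simp
  then have "(\<integral>x. complex_of_real ((cmod (d x))\<^sup>2) \<partial>M) = 0"
    by (simp only: complex_norm_square)
  then have "(\<integral>x. (cmod (d x))\<^sup>2 \<partial>M) = 0"
    using integral_complex_of_real[of M "\<lambda>x. (cmod (d x))\<^sup>2"] by (metis of_real_eq_0_iff)
  then show ?thesis using L2_norm_eq_0_iff[OF d] by (simp add: d_def k_def)
qed

section \<open>Averaging over noise as a Markov operator\<close>

definition noise_operator :: "('b \<times> 'c \<Rightarrow> 'a) \<Rightarrow> 'c measure \<Rightarrow> ('a \<Rightarrow> complex) \<Rightarrow> 'b \<Rightarrow> complex" where
  "noise_operator G U f y = (\<integral>u. f (G (y, u)) \<partial>U)"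

locale noisy_map = N: prob_space N + U: prob_space U + M: prob_space M
  for N :: "'b measure" and U :: "'c measure" and M :: "'a measure" +
  fixes G :: "'b \<times> 'c \<Rightarrow> 'a"
  assumes G[measurable]: "G \<in> measurable (N \<Otimes>\<^sub>M U) M" and distr_G: "distr (N \<Otimes>\<^sub>M U) M G = M"
begin

sublocale NU: pair_prob_space N U ..

abbreviation "\<Phi> \<equiv> noise_operator G U"

lemma L2_comp: assumes "f \<in> L2 M" shows "(\<lambda>z. f (G z)) \<in> L2 (N \<Otimes>\<^sub>M U)"
proof -
  have [measurable]: "f \<in> borel_measurable M" and i: "integrable M (\<lambda>x. (cmod (f x))\<^sup>2)"
    using assms by (auto simp: L2_def)
  from i have "integrable (distr (N \<Otimes>\<^sub>M U) M G) (\<lambda>x. (cmod (f x))\<^sup>2)" by (simp add: distr_G)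
  then show ?thesis by (subst (asm) integrable_distr_eq) (auto simp: L2_def)
qed

lemma integral_comp:
  fixes f :: "'a \<Rightarrow> 'e :: {banach, second_countable_topology}"
  shows "f \<in> borel_measurable M \<Longrightarrow> (\<integral>z. f (G z) \<partial>(N \<Otimes>\<^sub>M U)) = (\<integral>x. f x \<partial>M)"
  using integral_distr[OF G, of f] by (simp add: distr_G)

lemma AE_comp: assumes "AE x in M. P x" shows "AE y in N. AE u in U. P (G (y, u))"
  by (rule NU.AE_pair[of "\<lambda>z. P (G z)"], rule AE_distrD[OF G], subst distr_G, rule assms)

lemma AE_section_L2: assumes "f \<in> L2 M" shows "AE y in N. (\<lambda>u. f (G (y, u))) \<in> L2 U"
proof -
  have [measurable]: "f \<in> borel_measurable M" using assms by (auto simp: L2_def)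
  have "integrable (N \<Otimes>\<^sub>M U) (\<lambda>z. (cmod (f (G z)))\<^sup>2)" using L2_comp[OF assms] by (simp add: L2_def)
  from NU.AE_integrable_fst'[OF this] AE_space show ?thesis
    by eventually_elim (auto simp: L2_def intro!: measurable_compose[OF _ \<open>f \<in> borel_measurable M\<close>] measurable_Pair2[OF G])
qed

lemma AE_section_integrable: "f \<in> L2 M \<Longrightarrow> AE y in N. integrable U (\<lambda>u. f (G (y, u)))"
  by (drule AE_section_L2, erule eventually_mono) (rule L2_imp_integrable[OF U.finite_measure_axioms])

lemma noise_measurable: assumes "f \<in> L2 M" shows "\<Phi> f \<in> borel_measurable N"
proof -
  have [measurable]: "f \<in> borel_measurable M" using assms by (auto simp: L2_def)
  have "(\<lambda>(y, u). f (G (y, u))) \<in> borel_measurable (N \<Otimes>\<^sub>M U)" by simp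
  then show ?thesis unfolding noise_operator_def[abs_def] by (rule U.borel_measurable_lebesgue_integral)
qed

text \<open>Jensen's inequality in each section, then Fubini and \<open>distr_G\<close>, which turn
  the integral over pairs into one over \<open>M\<close>.\<close>

lemma noise_square_integral:
  assumes "f \<in> L2 M"
  shows "integrable N (\<lambda>y. (cmod (\<Phi> f y))\<^sup>2)"
    and "(\<integral>y. (cmod (\<Phi> f y))\<^sup>2 \<partial>N) \<le> (\<integral>x. (cmod (f x))\<^sup>2 \<partial>M)"
proof -
  note [measurable] = noise_measurable[OF assms]
  have [measurable]: "f \<in> borel_measurable M" using assms by (auto simp: L2_def)
  have i: "integrable (N \<Otimes>\<^sub>M U) (\<lambda>z. (cmod (f (G z)))\<^sup>2)" using L2_comp[OF assms] by (simp add: L2_def)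
  have ae: "AE y in N. (cmod (\<Phi> f y))\<^sup>2 \<le> (\<integral>u. (cmod (f (G (y, u))))\<^sup>2 \<partial>U)"
    using AE_section_L2[OF assms] unfolding noise_operator_def
    by eventually_elim (rule U.norm_expectation_square_le)
  note i' = NU.integrable_fst'[OF i]
  show int: "integrable N (\<lambda>y. (cmod (\<Phi> f y))\<^sup>2)"
    by (rule Bochner_Integration.integrable_bound[OF i']) (use ae in auto)
  have "(\<integral>y. (cmod (\<Phi> f y))\<^sup>2 \<partial>N) \<le> (\<integral>y. (\<integral>u. (cmod (f (G (y, u))))\<^sup>2 \<partial>U) \<partial>N)"
    by (rule integral_mono_AE[OF int i' ae])
  also have "\<dots> = (\<integral>x. (cmod (f x))\<^sup>2 \<partial>M)"
    using NU.integral_fst'[OF i] integral_comp[of "\<lambda>x. (cmod (f x))\<^sup>2"] by simp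
  finally show "(\<integral>y. (cmod (\<Phi> f y))\<^sup>2 \<partial>N) \<le> (\<integral>x. (cmod (f x))\<^sup>2 \<partial>M)" .
qed

lemma noise_L2: "f \<in> L2 M \<Longrightarrow> \<Phi> f \<in> L2 N"
  using noise_square_integral(1) noise_measurable by (auto simp: L2_def)

lemma noise_cong:
  assumes "f \<in> L2 M" "g \<in> L2 M" "AE x in M. f x = g x" shows "AE y in N. \<Phi> f y = \<Phi> g y"
proof -
  have [measurable]: "f \<in> borel_measurable M" "g \<in> borel_measurable M" using assms by (auto simp: L2_def)
  show ?thesis using AE_comp[OF assms(3)] AE_space
    by eventually_elim (auto simp: noise_operator_def intro!: integral_cong_AE)
qed

text \<open>The Bochner integral of a non-integrable section is 0 by default, which confines
  additivity to almost every \<open>y\<close>; homogeneity survives even there, so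
  \<open>noise_scale\<close> holds everywhere.\<close>

lemma noise_add:
  "f \<in> L2 M \<Longrightarrow> g \<in> L2 M \<Longrightarrow> AE y in N. \<Phi> (\<lambda>x. f x + g x) y = \<Phi> f y + \<Phi> g y"
  using AE_section_integrable[of f] AE_section_integrable[of g]
  by (auto simp: noise_operator_def elim: eventually_elim2)

lemma noise_scale: "\<Phi> (\<lambda>x. c * f x) y = c * \<Phi> f y"
  by (simp add: noise_operator_def)

lemma noise_linear_contraction: "L2_linear_contraction M N \<Phi>"
  unfolding L2_linear_contraction_def L2_norm_def
  by (intro conjI ballI allI impI noise_L2 noise_cong noise_add
      real_sqrt_le_mono noise_square_integral(2)) (simp_all add: noise_scale)

lemma noise_integral: assumes "f \<in> L2 M" shows "(\<integral>y. \<Phi> f y \<partial>N) = (\<integral>x. f x \<partial>M)"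
proof -
  have [measurable]: "f \<in> borel_measurable M" using assms by (auto simp: L2_def)
  have "integrable (N \<Otimes>\<^sub>M U) (\<lambda>z. f (G z))"
    using L2_imp_integrable[OF NU.finite_measure_axioms L2_comp[OF assms]] .
  from NU.integral_fst'[OF this] show ?thesis
    using integral_comp[of f] by (simp add: noise_operator_def)
qed

lemma noise_one: "\<Phi> (\<lambda>_. 1) y = 1"
  by (simp add: noise_operator_def U.prob_space)

lemma noise_nonneg:
  assumes "f \<in> L2 M" "AE x in M. f x \<in> \<real>\<^sub>\<ge>\<^sub>0" shows "AE y in N. \<Phi> f y \<in> \<real>\<^sub>\<ge>\<^sub>0"
proof -
  have [measurable]: "f \<in> borel_measurable M" using assms by (auto simp: L2_def)
  \<comment> \<open>Replacing the integrand by its modulus turns the complex integral into the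
    integral of a non-negative real function.\<close>
  have pos: "z = complex_of_real (cmod z)" if "z \<in> \<real>\<^sub>\<ge>\<^sub>0" for z
    using that by (auto elim!: nonneg_Reals_cases)
  show ?thesis using AE_comp[OF assms(2)] AE_space
  proof eventually_elim
    case (elim y)
    then have [measurable]: "(\<lambda>u. f (G (y, u))) \<in> borel_measurable U"
      by (intro measurable_compose[OF _ \<open>f \<in> borel_measurable M\<close>] measurable_Pair2[OF G])
    have "\<Phi> f y = (\<integral>u. complex_of_real (cmod (f (G (y, u)))) \<partial>U)"
      unfolding noise_operator_def by (rule integral_cong_AE) (use elim(1) in \<open>auto elim!: eventually_mono intro: pos\<close>)
    also have "\<dots> = complex_of_real (\<integral>u. cmod (f (G (y, u))) \<partial>U)" by simp
    finally show ?case by simp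
  qed
qed

lemma noise_markov: "markov_operator M N \<Phi>"
proof -
  \<comment> \<open>\<open>noise_integral\<close> is exactly the adjoint relation between the two
    constants 1.\<close>
  have "AE x in M. L2_adjoint M N \<Phi> (\<lambda>_. 1) x = 1"
    using noise_integral
    by (intro L2_adjoint_eqI L2_bounded[OF M.finite_measure_axioms, of _ 1]) (auto simp: L2_inner_def)
  then show ?thesis
    unfolding markov_operator_def
    by (intro conjI ballI allI impI noise_linear_contraction noise_nonneg) (simp_all add: noise_one)
qed

section \<open>The L2 closure of the range\<close>

definition approximable :: "('b \<Rightarrow> complex) \<Rightarrow> bool" where
  "approximable g \<longleftrightarrow> g \<in> L2 N \<and> (\<forall>\<delta>>0. \<exists>f\<in>L2 M. (\<integral>y. (cmod (\<Phi> f y - g y))\<^sup>2 \<partial>N) < \<delta>)"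

lemma approximable_image:
  assumes "f \<in> L2 M" "g \<in> L2 N" "AE y in N. \<Phi> f y = g y" shows "approximable g"
proof -
  have "(\<integral>y. (cmod (\<Phi> f y - g y))\<^sup>2 \<partial>N) = 0"
    using assms(3) by (subst L2_norm_eq_0_iff[OF L2_diff[OF noise_L2[OF assms(1)] assms(2)]]) auto
  then show ?thesis unfolding approximable_def using assms(1,2)
    by (intro conjI allI impI bexI[of _ f]) simp_all
qed

text \<open>A triangle inequality for squared distances. The factor 2 is the price for avoiding
  square roots and accounts for the tolerances \<open>\<delta> / 4\<close> below.\<close>

lemma square_integral_diff_le:
  assumes "f \<in> L2 N" "g \<in> L2 N" "h \<in> L2 N"
  shows "(\<integral>y. (cmod (f y - h y))\<^sup>2 \<partial>N) \<le> 2 * (\<integral>y. (cmod (f y - g y))\<^sup>2 \<partial>N) + 2 * (\<integral>y. (cmod (g y - h y))\<^sup>2 \<partial>N)"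
proof -
  have i: "integrable N (\<lambda>y. (cmod (f y - h y))\<^sup>2)" "integrable N (\<lambda>y. (cmod (f y - g y))\<^sup>2)"
    "integrable N (\<lambda>y. (cmod (g y - h y))\<^sup>2)"
    using L2_diff[OF assms(1,3)] L2_diff[OF assms(1,2)] L2_diff[OF assms(2,3)] by (auto simp: L2_def)
  have "(\<integral>y. (cmod (f y - h y))\<^sup>2 \<partial>N) \<le> (\<integral>y. 2 * (cmod (f y - g y))\<^sup>2 + 2 * (cmod (g y - h y))\<^sup>2 \<partial>N)"
    using cmod_add_square_le[of "f y - g y" "g y - h y" for y]
    by (intro integral_mono i Bochner_Integration.integrable_add integrable_mult_right) simp
  then show ?thesis using i by simp
qed

lemma approximable_limit:
  assumes g: "g \<in> L2 N"
    and h: "\<And>\<delta>. 0 < \<delta> \<Longrightarrow> \<exists>h. approximable h \<and> (\<integral>y. (cmod (h y - g y))\<^sup>2 \<partial>N) < \<delta>"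
  shows "approximable g"
  unfolding approximable_def
proof (intro conjI allI impI g)
  fix \<delta> :: real assume "0 < \<delta>"
  then obtain h where h: "approximable h" "(\<integral>y. (cmod (h y - g y))\<^sup>2 \<partial>N) < \<delta> / 4"
    using h[of "\<delta> / 4"] by auto
  obtain f where f: "f \<in> L2 M" "(\<integral>y. (cmod (\<Phi> f y - h y))\<^sup>2 \<partial>N) < \<delta> / 4" and hL: "h \<in> L2 N"
    using h(1) \<open>0 < \<delta>\<close> unfolding approximable_def by (meson divide_pos_pos zero_less_numeral)
  show "\<exists>f\<in>L2 M. (\<integral>y. (cmod (\<Phi> f y - g y))\<^sup>2 \<partial>N) < \<delta>"
    using square_integral_diff_le[OF noise_L2[OF f(1)] hL g] f h(2) by (intro bexI[of _ f]) auto
qed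

text \<open>Complements and simple functions are controlled on \<open>space N\<close> only, whereas
  functions are equal in HOL only if they agree on the whole type.\<close>

lemma approximable_cong:
  assumes "approximable h" "g \<in> L2 N" "\<And>y. y \<in> space N \<Longrightarrow> h y = g y" shows "approximable g"
proof (rule approximable_limit[OF assms(2)])
  fix \<delta> :: real assume "0 < \<delta>"
  have "(\<integral>y. (cmod (h y - g y))\<^sup>2 \<partial>N) = (\<integral>y. 0 \<partial>N)"
    by (rule Bochner_Integration.integral_cong) (simp_all add: assms(3))
  then show "\<exists>h. approximable h \<and> (\<integral>y. (cmod (h y - g y))\<^sup>2 \<partial>N) < \<delta>"
    using assms(1) \<open>0 < \<delta>\<close> by (intro exI[of _ h]) simp
qed

lemma approximable_add:
  assumes "approximable g" "approximable h" shows "approximable (\<lambda>y. g y + h y)"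
  unfolding approximable_def
proof (intro conjI allI impI)
  have gh: "g \<in> L2 N" "h \<in> L2 N" using assms by (auto simp: approximable_def)
  then show L: "(\<lambda>y. g y + h y) \<in> L2 N" by (rule L2_add)
  fix \<delta> :: real assume "0 < \<delta>"
  then have "0 < \<delta> / 4" by simp
  then obtain u v where u: "u \<in> L2 M" "(\<integral>y. (cmod (\<Phi> u y - g y))\<^sup>2 \<partial>N) < \<delta> / 4"
    and v: "v \<in> L2 M" "(\<integral>y. (cmod (\<Phi> v y - h y))\<^sup>2 \<partial>N) < \<delta> / 4"
    using assms unfolding approximable_def by meson
  let ?w = "\<lambda>y. \<Phi> u y + h y"
  note [measurable] = noise_measurable[OF u(1)] noise_measurable[OF v(1)] noise_measurable[OF L2_add[OF u(1) v(1)]]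
  have [measurable]: "h \<in> borel_measurable N" using gh(2) by (simp add: L2_def)
  have "(\<integral>y. (cmod (\<Phi> (\<lambda>x. u x + v x) y - ?w y))\<^sup>2 \<partial>N) = (\<integral>y. (cmod (\<Phi> v y - h y))\<^sup>2 \<partial>N)"
  proof (rule integral_cong_AE)
    show "AE y in N. (cmod (\<Phi> (\<lambda>x. u x + v x) y - ?w y))\<^sup>2 = (cmod (\<Phi> v y - h y))\<^sup>2"
      using noise_add[OF u(1) v(1)] by eventually_elim simp
  qed measurable
  then have "(\<integral>y. (cmod (\<Phi> (\<lambda>x. u x + v x) y - (g y + h y)))\<^sup>2 \<partial>N) < \<delta>"
    using square_integral_diff_le[OF noise_L2[OF L2_add[OF u(1) v(1)]] L2_add[OF noise_L2[OF u(1)] gh(2)] L]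
      u v by simp
  then show "\<exists>f\<in>L2 M. (\<integral>y. (cmod (\<Phi> f y - (g y + h y)))\<^sup>2 \<partial>N) < \<delta>"
    using L2_add[OF u(1) v(1)] by blast
qed

lemma approximable_scale:
  assumes "approximable g" shows "approximable (\<lambda>y. c * g y)"
  unfolding approximable_def
proof (intro conjI allI impI)
  show "(\<lambda>y. c * g y) \<in> L2 N" using assms by (auto simp: approximable_def intro: L2_scale)
  fix \<delta> :: real assume d: "0 < \<delta>"
  \<comment> \<open>The \<open>+ 1\<close> keeps the denominator positive when
    \<open>c = 0\<close>.\<close>
  have pos: "0 < (cmod c)\<^sup>2 + 1" by (rule add_nonneg_pos) auto
  then obtain f where f: "f \<in> L2 M" "(\<integral>y. (cmod (\<Phi> f y - g y))\<^sup>2 \<partial>N) < \<delta> / ((cmod c)\<^sup>2 + 1)"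
    using assms d unfolding approximable_def by (meson divide_pos_pos)
  have "(cmod (\<Phi> (\<lambda>x. c * f x) y - c * g y))\<^sup>2 = (cmod c)\<^sup>2 * (cmod (\<Phi> f y - g y))\<^sup>2" for y
    unfolding noise_scale by (simp add: norm_mult power_mult_distrib flip: right_diff_distrib)
  then have "(\<integral>y. (cmod (\<Phi> (\<lambda>x. c * f x) y - c * g y))\<^sup>2 \<partial>N) = (cmod c)\<^sup>2 * (\<integral>y. (cmod (\<Phi> f y - g y))\<^sup>2 \<partial>N)"
    by simp
  also have "\<dots> \<le> ((cmod c)\<^sup>2 + 1) * (\<integral>y. (cmod (\<Phi> f y - g y))\<^sup>2 \<partial>N)"
    by (intro mult_right_mono) auto
  also have "\<dots> < \<delta>" using f(2) pos by (simp add: pos_less_divide_eq mult.commute)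
  finally show "\<exists>f\<in>L2 M. (\<integral>y. (cmod (\<Phi> f y - c * g y))\<^sup>2 \<partial>N) < \<delta>"
    using L2_scale[OF f(1)] by blast
qed

lemma approximable_sum:
  assumes "finite S" "\<And>s. s \<in> S \<Longrightarrow> approximable (g s)" shows "approximable (\<lambda>y. \<Sum>s\<in>S. g s y)"
  using assms
proof (induction S rule: finite_induct)
  case empty
  have "(\<lambda>_. 0) \<in> L2 N" "(\<lambda>_. 0) \<in> L2 M" by (auto simp: L2_def)
  then show ?case by (intro approximable_image[of "\<lambda>_. 0"]) (auto simp: noise_operator_def)
qed (auto intro: approximable_add)

lemma indicator_L2: "A \<in> sets N \<Longrightarrow> (\<lambda>y. indicator A y :: complex) \<in> L2 N"
  by (rule L2_bounded[OF N.finite_measure_axioms, of _ 1]) (auto simp: indicator_def)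

text \<open>Dynkin's argument: the closure of the range is a linear space containing 1, which
  handles complements. A countable disjoint union is the L2 limit of its finite partial unions, by
  continuity of the measure.\<close>

lemma approximable_indicator:
  assumes E: "sets N = sigma_sets (space N) E" "E \<subseteq> Pow (space N)" "Int_stable E"
    and *: "\<And>A. A \<in> E \<Longrightarrow> approximable (indicator A)" and A: "A \<in> sets N"
  shows "approximable (indicator A)"
proof -
  have one: "approximable (\<lambda>_. 1)"
    by (rule approximable_image[of "\<lambda>_. 1"])
       (auto simp: noise_one intro: L2_bounded[OF N.finite_measure_axioms, of _ 1] L2_bounded[OF M.finite_measure_axioms, of _ 1])
  from E(3,2) A[unfolded E(1)] show ?thesis
  proof (induction rule: sigma_sets_induct_disjoint)
    case (basic A) then show ?case by (rule *)
  next
    case empty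
    show ?case using approximable_sum[of "{}"] by (simp add: indicator_def)
  next
    case (compl A)
    then have [measurable]: "A \<in> sets N" by (simp add: E(1))
    have L: "indicator (space N - A) \<in> L2 N" by (rule indicator_L2) auto
    have "approximable (\<lambda>y. 1 + (-1) * indicator A y)"
      by (intro approximable_add one approximable_scale compl)
    then show ?case by (rule approximable_cong[OF _ L]) (auto simp: indicator_def)
  next
    case (union A)
    then have m[measurable]: "A i \<in> sets N" for i by (auto simp: E(1))
    let ?U = "\<Union>i. A i"
    have L: "indicator ?U \<in> L2 N" by (rule indicator_L2) auto
    show ?case
    proof (rule approximable_limit[OF L])
      fix \<delta> :: real assume "0 < \<delta>"
      have "(\<lambda>n. measure N (\<Union>i<n. A i)) \<longlonglongrightarrow> measure N (\<Union>n. \<Union>i<n. A i)"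
        by (rule N.finite_Lim_measure_incseq) (auto simp: incseq_def intro: less_le_trans)
      moreover have "(\<Union>n. \<Union>i<n. A i) = ?U" by auto
      ultimately have "(\<lambda>n. measure N (\<Union>i<n. A i)) \<longlonglongrightarrow> measure N ?U" by simp
      then have "eventually (\<lambda>n. measure N ?U - \<delta> < measure N (\<Union>i<n. A i)) sequentially"
        using \<open>0 < \<delta>\<close> by (intro order_tendstoD) auto
      then obtain n where n: "measure N ?U - \<delta> < measure N (\<Union>i<n. A i)"
        by (auto simp: eventually_sequentially)
      let ?h = "\<lambda>y. \<Sum>i<n. indicator (A i) y :: complex"
      have h: "?h y = indicator (\<Union>i<n. A i) y" for y
        using union(1) by (subst indicator_UN_disjoint) (auto simp: disjoint_family_on_def)
      have "(\<integral>y. (cmod (?h y - indicator ?U y))\<^sup>2 \<partial>N) = (\<integral>y. indicator (?U - (\<Union>i<n. A i)) y \<partial>N)"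
        unfolding h by (rule Bochner_Integration.integral_cong) (auto simp: indicator_def)
      also have "\<dots> = measure N ?U - measure N (\<Union>i<n. A i)"
        by (subst N.finite_measure_Diff[symmetric]) auto
      also have "\<dots> < \<delta>" using n by simp
      finally show "\<exists>h. approximable h \<and> (\<integral>y. (cmod (h y - indicator ?U y))\<^sup>2 \<partial>N) < \<delta>"
        using approximable_sum[of "{..<n}" "\<lambda>i. indicator (A i)"] union by blast
    qed
  qed
qed

lemma approximable_L2:
  assumes *: "\<And>A. A \<in> sets N \<Longrightarrow> approximable (indicator A)" and g: "g \<in> L2 N"
  shows "approximable g"
proof (rule approximable_limit[OF g])
  fix \<delta> :: real assume "0 < \<delta>"
  have [measurable]: "g \<in> borel_measurable N" and i: "integrable N (\<lambda>y. (cmod (g y))\<^sup>2)"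
    using g by (auto simp: L2_def)
  from borel_measurable_implies_sequence_metric[of g N 0] obtain s where
    "(\<forall>i. simple_function N (s i)) \<and> (\<forall>y\<in>space N. (\<lambda>i. s i y) \<longlonglongrightarrow> g y) \<and>
      (\<forall>i. \<forall>y\<in>space N. dist (s i y) 0 \<le> 2 * dist (g y) 0)"
    by auto
  then have s: "\<And>i. simple_function N (s i)" "\<And>y. y \<in> space N \<Longrightarrow> (\<lambda>i. s i y) \<longlonglongrightarrow> g y"
    "\<And>i y. y \<in> space N \<Longrightarrow> cmod (s i y) \<le> 2 * cmod (g y)"
    by (simp_all add: dist_norm)
  note [measurable] = borel_measurable_simple_function[OF s(1)]
  have app: "approximable (s i)" for i
  proof -
    have fin: "finite (s i ` space N)" using s(1) by (simp add: simple_function_def)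
    let ?t = "\<lambda>y. \<Sum>v\<in>s i ` space N. v * indicator (s i -` {v} \<inter> space N) y"
    have t: "?t y = s i y" if "y \<in> space N" for y
      using that fin by (simp add: indicator_def if_distrib[of "\<lambda>z. _ * z"] cong: if_cong)
    have "approximable ?t"
      by (intro approximable_sum[OF fin] approximable_scale * simple_functionD(2)[OF s(1)])
    moreover have L: "s i \<in> L2 N"
    proof -
      have "integrable N (\<lambda>y. (cmod (s i y))\<^sup>2)"
        by (rule Bochner_Integration.integrable_bound[OF integrable_mult_right[OF i, of 4]])
           (use power_mono[OF s(3), of _ i 2] in \<open>auto simp: power_mult_distrib\<close>)
      then show ?thesis by (simp add: L2_def)
    qed
    ultimately show ?thesis by (rule approximable_cong) (rule t)
  qed
  have "(\<lambda>n. \<integral>y. (cmod (s n y - g y))\<^sup>2 \<partial>N) \<longlonglongrightarrow> (\<integral>y. 0 \<partial>N)"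
  \<comment> \<open>The modulus of \<open>s n y\<close> is at most twice that of \<open>g y\<close>,
    so the error is at most three times it; squaring gives the 9.\<close>
  proof (rule integral_dominated_convergence[where w = "\<lambda>y. 9 * (cmod (g y))\<^sup>2"])
    show "AE y in N. (\<lambda>n. (cmod (s n y - g y))\<^sup>2) \<longlonglongrightarrow> 0"
      using s(2) by (intro AE_I2) (auto intro!: tendsto_eq_intros)
    show "AE y in N. norm ((cmod (s n y - g y))\<^sup>2) \<le> 9 * (cmod (g y))\<^sup>2" for n
    proof (rule AE_I2)
      fix y assume "y \<in> space N"
      then have "cmod (s n y - g y) \<le> 3 * cmod (g y)"
        using s(3)[of y n] norm_triangle_ineq4[of "s n y" "g y"] by simp
      then show "norm ((cmod (s n y - g y))\<^sup>2) \<le> 9 * (cmod (g y))\<^sup>2"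
        using power_mono[of "cmod (s n y - g y)" "3 * cmod (g y)" 2] by (simp add: power_mult_distrib)
    qed
  qed (use i in auto)
  then have "eventually (\<lambda>n. (\<integral>y. (cmod (s n y - g y))\<^sup>2 \<partial>N) < \<delta>) sequentially"
    using \<open>0 < \<delta>\<close> by (intro order_tendstoD) auto
  then obtain n where "(\<integral>y. (cmod (s n y - g y))\<^sup>2 \<partial>N) < \<delta>"
    by (auto simp: eventually_sequentially)
  then show "\<exists>h. approximable h \<and> (\<integral>y. (cmod (h y - g y))\<^sup>2 \<partial>N) < \<delta>" using app by blast
qed

lemma dense_range_if_approximable:
  assumes "\<And>g. g \<in> L2 N \<Longrightarrow> approximable g" shows "L2_dense_range M N \<Phi>"
  unfolding L2_dense_range_def
proof (intro ballI allI impI)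
  fix g and \<epsilon> :: real assume "g \<in> L2 N" "0 < \<epsilon>"
  then obtain f where "f \<in> L2 M" "(\<integral>y. (cmod (\<Phi> f y - g y))\<^sup>2 \<partial>N) < \<epsilon>\<^sup>2"
    using assms unfolding approximable_def by (meson zero_less_power)
  then show "\<exists>f\<in>L2 M. L2_norm N (\<lambda>y. \<Phi> f y - g y) < \<epsilon>"
    using \<open>0 < \<epsilon>\<close> by (intro bexI[of _ f]) (auto simp: L2_norm_def intro!: real_less_lsqrt)
qed

end

subsection \<open>Bernoulli measures\<close>

text \<open>The letters are the reals 0 and 1, so that sequences have type \<open>point\<close>.
  Coordinates are therefore letters only almost surely.\<close>

definition bern :: "real \<Rightarrow> real measure" where
  "bern a = distr (measure_pmf (bernoulli_pmf a)) borel of_bool"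

lemma sets_bern[simp, measurable_cong]: "sets (bern a) = sets borel"
  and space_bern[simp]: "space (bern a) = UNIV"
  by (simp_all add: bern_def)

lemma prob_space_bern: "prob_space (bern a)"
  unfolding bern_def by (rule prob_space.prob_space_distr[OF measure_pmf.prob_space_axioms]) simp

lemma integral_bern:
  fixes f :: "real \<Rightarrow> 'e :: {banach, second_countable_topology}"
  assumes "f \<in> borel_measurable borel" "0 \<le> a" "a \<le> 1"
  shows "integrable (bern a) f" and "(\<integral>t. f t \<partial>bern a) = a *\<^sub>R f 1 + (1 - a) *\<^sub>R f 0"
proof -
  show "integrable (bern a) f"
    unfolding bern_def using assms(1)
    by (subst integrable_distr_eq) (auto intro!: integrable_measure_pmf_finite)
  show "(\<integral>t. f t \<partial>bern a) = a *\<^sub>R f 1 + (1 - a) *\<^sub>R f 0"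
    unfolding bern_def using assms
    by (subst integral_distr) (auto simp: integral_measure_pmf[of UNIV] UNIV_bool)
qed

lemma AE_bern: "AE t in bern a. t \<in> {0, 1}"
  unfolding bern_def by (subst AE_distr_iff) auto

definition bern_seq :: "real \<Rightarrow> (nat \<Rightarrow> real) measure" where
  "bern_seq a = PiM UNIV (\<lambda>_. bern a)"

lemma sets_bern_seq[simp, measurable_cong]: "sets (bern_seq a) = sets (PiM UNIV (\<lambda>_. borel))"
  unfolding bern_seq_def by (intro sets_PiM_cong) simp_all

lemma space_bern_seq[simp]: "space (bern_seq a) = UNIV"
  by (simp add: bern_seq_def space_PiM PiE_UNIV_domain)

lemma prob_space_bern_seq: "prob_space (bern_seq a)"
  unfolding bern_seq_def by (intro prob_space_PiM prob_space_bern)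

lemma distr_bern_seq_component: "distr (bern_seq a) borel (\<lambda>x. x i) = bern a"
proof -
  have "distr (bern_seq a) borel (\<lambda>x. x i) = distr (PiM UNIV (\<lambda>_. bern a)) (bern a) (\<lambda>x. x i)"
    by (intro distr_cong) (auto simp: bern_seq_def)
  then show ?thesis using distr_PiM_component[of UNIV "\<lambda>_. bern a" i] prob_space_bern by simp
qed

lemma AE_bern_seq: "AE x in bern_seq a. \<forall>i. x i \<in> {0, 1}"
  unfolding bern_seq_def AE_all_countable
  by (intro allI AE_PiM_component prob_space_bern UNIV_I AE_bern)

lemma indep_vars_bern_seq:
  "prob_space.indep_vars (bern_seq a) (\<lambda>_. borel) (\<lambda>i x. x i) UNIV"
proof -
  interpret prob_space "bern_seq a" by (rule prob_space_bern_seq)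
  have "distr (bern_seq a) (PiM UNIV (\<lambda>_. borel)) (\<lambda>x. \<lambda>i\<in>UNIV. x i) = PiM UNIV (\<lambda>_. bern a)"
    by (simp add: restrict_UNIV distr_id2 flip: bern_seq_def)
  then show ?thesis
    by (subst indep_vars_iff_distr_eq_PiM') (auto simp: distr_bern_seq_component)
qed

lemma integral_bern_seq_prod:
  fixes f :: "nat \<Rightarrow> real \<Rightarrow> 'e :: {real_normed_field, banach, second_countable_topology}"
  assumes J: "finite J" and f: "\<And>i. i \<in> J \<Longrightarrow> f i \<in> borel_measurable borel" and a: "0 \<le> a" "a \<le> 1"
  shows "integrable (bern_seq a) (\<lambda>x. \<Prod>i\<in>J. f i (x i))"
    and "(\<integral>x. (\<Prod>i\<in>J. f i (x i)) \<partial>bern_seq a) = (\<Prod>i\<in>J. \<integral>t. f i t \<partial>bern a)"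
proof -
  interpret prob_space "bern_seq a" by (rule prob_space_bern_seq)
  have ind: "indep_vars (\<lambda>_. borel) (\<lambda>i x. f i (x i)) J"
    using indep_vars_compose2[OF indep_vars_subset[OF indep_vars_bern_seq subset_UNIV], of J f "\<lambda>_. borel"] f by simp
  have 1: "integrable (bern_seq a) (\<lambda>x. f i (x i))"
    and 2: "(\<integral>x. f i (x i) \<partial>bern_seq a) = (\<integral>t. f i t \<partial>bern a)" if "i \<in> J" for i
    using integral_bern(1)[OF f[OF that] a] integral_distr[of "\<lambda>x. x i" "bern_seq a" borel "f i"]
      integrable_distr_eq[of "\<lambda>x. x i" "bern_seq a" borel "f i"] f[OF that]
    by (simp_all add: distr_bern_seq_component)
  show "integrable (bern_seq a) (\<lambda>x. \<Prod>i\<in>J. f i (x i))"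
    by (rule indep_vars_integrable[OF J ind 1])
  show "(\<integral>x. (\<Prod>i\<in>J. f i (x i)) \<partial>bern_seq a) = (\<Prod>i\<in>J. \<integral>t. f i t \<partial>bern a)"
    using indep_vars_lebesgue_integral[OF J ind 1] 2 by simp
qed

text \<open>\<open>b\<close>, \<open>d\<close> and \<open>c\<close> are the parameters of source,
  noise and output. Given the source letter \<open>t\<close>, the output letter
  \<open>g (t, s)\<close> is 1 with probability \<open>\<alpha> * t + \<beta>\<close>; that
  \<open>\<alpha>\<close> is nonzero means that the two rows of the stochastic matrix differ, that
  is, the matrix is invertible.\<close>

locale bern_kernel =
  fixes b c d \<alpha> \<beta> :: real and g :: "real \<times> real \<Rightarrow> real"
  assumes bd: "0 \<le> b" "b \<le> 1" "0 \<le> d" "d \<le> 1"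
    and g[measurable]: "g \<in> borel_measurable borel"
    and g01: "\<And>t s. t \<in> {0, 1} \<Longrightarrow> s \<in> {0, 1} \<Longrightarrow> g (t, s) \<in> {0, 1}"
    and affine: "\<And>t. t \<in> {0, 1} \<Longrightarrow> d * g (t, 1) + (1 - d) * g (t, 0) = \<alpha> * t + \<beta>"
    and c: "c = \<alpha> * b + \<beta>" and \<alpha>: "\<alpha> \<noteq> 0"
begin

lemma g_pair[measurable]: "g \<in> borel_measurable (borel \<Otimes>\<^sub>M borel)"
  using g by (simp add: borel_prod)

lemma c_bounds: "0 \<le> c" "c \<le> 1"
proof -
  have "c = b * (\<alpha> * 1 + \<beta>) + (1 - b) * (\<alpha> * 0 + \<beta>)" by (simp add: c algebra_simps)
  also have "\<dots> = b * (d * g (1, 1) + (1 - d) * g (1, 0)) + (1 - b) * (d * g (0, 1) + (1 - d) * g (0, 0))"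
    by (simp only: affine[of 0] affine[of 1] insert_iff simp_thms)
  finally have c': "c = \<dots>" .
  have r: "0 \<le> p * u + (1 - p) * v \<and> p * u + (1 - p) * v \<le> 1"
    if "0 \<le> p" "p \<le> 1" "0 \<le> u" "u \<le> 1" "0 \<le> v" "v \<le> 1" for p u v :: real
    using that convex_bound_le[of u 1 v p "1 - p"] by simp
  have gb: "0 \<le> g (t, s) \<and> g (t, s) \<le> 1" if "t \<in> {0, 1}" "s \<in> {0, 1}" for t s
    using g01[OF that] by auto
  show "0 \<le> c" "c \<le> 1" unfolding c' using bd gb r by (auto intro!: r[THEN conjunct1] r[THEN conjunct2])
qed

text \<open>On \<open>{0, 1}\<close> every \<open>h\<close> agrees with an affine function, so the
  average depends only on the probability of the output letter 1.\<close>

lemma integral_kernel: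
  fixes h :: "real \<Rightarrow> 'e :: {real_normed_field, banach, second_countable_topology}"
  assumes [measurable]: "h \<in> borel_measurable borel" and t: "t \<in> {0, 1}"
  shows "(\<integral>s. h (g (t, s)) \<partial>bern d) = h 0 + of_real (\<alpha> * t + \<beta>) * (h 1 - h 0)"
proof -
  have h: "h (g (t, s)) = h 0 + of_real (g (t, s)) * (h 1 - h 0)" if "s \<in> {0, 1}" for s
    using g01[OF t that] by auto
  have "(\<integral>s. h (g (t, s)) \<partial>bern d) = d *\<^sub>R h (g (t, 1)) + (1 - d) *\<^sub>R h (g (t, 0))"
    by (rule integral_bern) (use bd in measurable)
  also have "\<dots> = h 0 + of_real (d * g (t, 1) + (1 - d) * g (t, 0)) * (h 1 - h 0)"
    by (simp add: h scaleR_conv_of_real algebra_simps)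
  finally show ?thesis by (simp only: affine[OF t])
qed

lemma integral_kernel2:
  fixes h :: "real \<Rightarrow> 'e :: {real_normed_field, banach, second_countable_topology}"
  assumes [measurable]: "h \<in> borel_measurable borel"
  shows "(\<integral>t. (\<integral>s. h (g (t, s)) \<partial>bern d) \<partial>bern b) = (\<integral>t. h t \<partial>bern c)"
proof -
  interpret D: prob_space "bern d" by (rule prob_space_bern)
  have "(\<lambda>t. \<integral>s. h (g (t, s)) \<partial>bern d) \<in> borel_measurable borel" by measurable
  then have "(\<integral>t. (\<integral>s. h (g (t, s)) \<partial>bern d) \<partial>bern b)
    = b *\<^sub>R (h 0 + of_real (\<alpha> * 1 + \<beta>) * (h 1 - h 0)) + (1 - b) *\<^sub>R (h 0 + of_real (\<alpha> * 0 + \<beta>) * (h 1 - h 0))"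
    using bd by (subst integral_bern(2)) (simp_all only: integral_kernel assms insert_iff simp_thms)
  also have "\<dots> = c *\<^sub>R h 1 + (1 - c) *\<^sub>R h 0"
    by (simp add: c scaleR_conv_of_real algebra_simps)
  also have "\<dots> = (\<integral>t. h t \<partial>bern c)" using integral_bern(2)[OF assms c_bounds] by simp
  finally show ?thesis .
qed

definition G :: "(nat \<Rightarrow> real) \<times> (nat \<Rightarrow> real) \<Rightarrow> nat \<Rightarrow> real" where
  "G z n = g (fst z n, snd z n)"

lemma G_measurable: "G \<in> measurable (bern_seq b \<Otimes>\<^sub>M bern_seq d) (bern_seq c)"
proof -
  have "G \<in> measurable (PiM UNIV (\<lambda>_. borel) \<Otimes>\<^sub>M PiM UNIV (\<lambda>_. borel)) (PiM UNIV (\<lambda>_. borel))"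
    unfolding G_def[abs_def]
    by (rule measurable_PiM_single') (simp_all add: PiE_UNIV_domain, measurable)
  also have "\<dots> = measurable (bern_seq b \<Otimes>\<^sub>M bern_seq d) (bern_seq c)"
    by (intro measurable_cong_sets sets_pair_measure_cong) simp_all
  finally show ?thesis .
qed

lemma integral_noise_prod:
  fixes h :: "nat \<Rightarrow> real \<Rightarrow> 'e :: {real_normed_field, banach, second_countable_topology}"
  assumes "finite J" "\<And>i. i \<in> J \<Longrightarrow> h i \<in> borel_measurable borel"
  shows "(\<integral>u. (\<Prod>i\<in>J. h i (G (y, u) i)) \<partial>bern_seq d) = (\<Prod>i\<in>J. \<integral>s. h i (g (y i, s)) \<partial>bern d)"
  unfolding G_def using assms bd
  by (simp add: integral_bern_seq_prod(2)[of J "\<lambda>i s. h i (g (y i, s))"])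

text \<open>Cylinders suffice, and their indicators are products over sites. Independence is used
  twice, for the noise with \<open>y\<close> fixed and then for \<open>y\<close>, which leaves the
  one-site identity \<open>integral_kernel2\<close>.\<close>

lemma distr_G: "distr (bern_seq b \<Otimes>\<^sub>M bern_seq d) (bern_seq c) G = bern_seq c"
proof -
  interpret B: prob_space "bern_seq b" by (rule prob_space_bern_seq)
  interpret D: prob_space "bern_seq d" by (rule prob_space_bern_seq)
  interpret C: prob_space "bern_seq c" by (rule prob_space_bern_seq)
  interpret BD: pair_prob_space "bern_seq b" "bern_seq d" ..
  interpret d: prob_space "bern d" by (rule prob_space_bern)
  note [measurable] = G_measurable
  let ?D = "distr (bern_seq b \<Otimes>\<^sub>M bern_seq d) (bern_seq c) G"
  interpret DD: prob_space ?D by (rule BD.prob_space_distr[OF G_measurable])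
  show ?thesis
  proof (rule measure_eqI_PiM_infinite)
    show "sets ?D = sets (PiM UNIV (\<lambda>_. bern c))" "sets (bern_seq c) = sets (PiM UNIV (\<lambda>_. bern c))"
      by (simp_all add: bern_seq_def)
    fix A :: "nat \<Rightarrow> real set" and J :: "nat set"
    assume J: "finite J" and A: "\<And>i. i \<in> J \<Longrightarrow> A i \<in> sets (bern c)"
    define Z where "Z = prod_emb UNIV (\<lambda>_. bern c) J (Pi\<^sub>E J A)"
    have Zs[measurable]: "Z \<in> sets (bern_seq c)"
      unfolding Z_def bern_seq_def using J A by (intro sets_PiM_I) auto
    have ind: "indicator Z x = (\<Prod>i\<in>J. indicator (A i) (x i) :: real)" for x
    proof (cases "x \<in> Z")
      case True
      then have "x i \<in> A i" if "i \<in> J" for i using that by (auto simp: Z_def prod_emb_def)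
      then show ?thesis using True by simp
    next
      case False
      then have "\<exists>i\<in>J. x i \<notin> A i" by (auto simp: Z_def prod_emb_def PiE_iff)
      then show ?thesis using False J by (auto simp: prod_zero_iff indicator_def)
    qed
    have Am: "(indicator (A i) :: real \<Rightarrow> real) \<in> borel_measurable borel" if "i \<in> J" for i
      using A[OF that] by simp
    have km: "(\<lambda>t. \<integral>s. indicator (A i) (g (t, s)) \<partial>bern d :: real) \<in> borel_measurable borel" if "i \<in> J" for i
    proof -
      note [measurable] = Am[OF that]
      show ?thesis by measurable
    qed
    have int: "integrable (bern_seq b \<Otimes>\<^sub>M bern_seq d) (\<lambda>z. indicator Z (G z) :: real)"
      by (rule BD.integrable_const_bound[of _ 1]) auto
    have "measure ?D Z = (\<integral>x. indicator Z x \<partial>?D)" by simp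
    also have "\<dots> = (\<integral>z. indicator Z (G z) \<partial>(bern_seq b \<Otimes>\<^sub>M bern_seq d))"
      by (rule integral_distr) measurable
    also have "\<dots> = (\<integral>y. (\<integral>u. indicator Z (G (y, u)) \<partial>bern_seq d) \<partial>bern_seq b)"
      using BD.integral_fst'[OF int] by simp
    also have "\<dots> = (\<integral>y. (\<Prod>i\<in>J. \<integral>s. indicator (A i) (g (y i, s)) \<partial>bern d) \<partial>bern_seq b)"
      unfolding ind by (intro Bochner_Integration.integral_cong refl integral_noise_prod[OF J Am])
    also have "\<dots> = (\<Prod>i\<in>J. \<integral>t. (\<integral>s. indicator (A i) (g (t, s)) \<partial>bern d) \<partial>bern b)"
      using J km bd(1,2) by (rule integral_bern_seq_prod(2))
    also have "\<dots> = (\<integral>x. indicator Z x \<partial>bern_seq c)"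
      unfolding ind by (simp add: integral_bern_seq_prod(2)[OF J Am c_bounds] integral_kernel2[OF Am])
    also have "\<dots> = measure (bern_seq c) Z" by simp
    finally show "emeasure ?D Z = emeasure (bern_seq c) Z"
      by (simp add: DD.emeasure_eq_measure C.emeasure_eq_measure)
  qed (rule DD.finite_measure_axioms)
qed

sublocale noisy_map "bern_seq b" "bern_seq d" "bern_seq c" G
  by (intro noisy_map.intro noisy_map_axioms.intro prob_space_bern_seq G_measurable distr_G)

lemma noise_cylinder:
  assumes J: "finite J" and A: "\<And>i. i \<in> J \<Longrightarrow> A i \<in> sets borel"
  shows "approximable (indicator {x. \<forall>i\<in>J. x i \<in> A i})"
proof (rule approximable_image)
  define p q :: "nat \<Rightarrow> complex" where "p i = indicator (A i) 0" and "q i = indicator (A i) 1 - indicator (A i) 0" for i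
  \<comment> \<open>The kernel maps \<open>e i\<close> to the indicator of \<open>A i\<close>, as both are affine on \<open>{0, 1}\<close>.\<close>
  define e :: "nat \<Rightarrow> real \<Rightarrow> complex" where "e i s = p i + q i * of_real ((s - \<beta>) / \<alpha>)" for i s
  let ?f = "\<lambda>x. \<Prod>i\<in>J. e i (x i)"
  have em[measurable]: "e i \<in> borel_measurable borel" for i
    unfolding e_def[abs_def] by measurable
  \<comment> \<open>\<open>e i\<close> is affine on the whole line and in general unbounded, so
    square integrability comes from independence of the sites and not from a uniform bound.\<close>
  have "integrable (bern_seq c) (\<lambda>x. \<Prod>i\<in>J. (cmod (e i (x i)))\<^sup>2)"
    by (rule integral_bern_seq_prod(1)[OF J _ c_bounds]) measurable
  then show "?f \<in> L2 (bern_seq c)"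
    by (auto simp: L2_def prod_norm[symmetric] prod_power_distrib)
  show "indicator {x. \<forall>i\<in>J. x i \<in> A i} \<in> L2 (bern_seq b)"
  proof (rule indicator_L2)
    have "{x \<in> space (bern_seq b). \<forall>i\<in>J. x i \<in> A i} \<in> sets (bern_seq b)"
      using J A by measurable
    then show "{x. \<forall>i\<in>J. x i \<in> A i} \<in> sets (bern_seq b)" by simp
  qed
  show "AE y in bern_seq b. noise_operator G (bern_seq d) ?f y = indicator {x. \<forall>i\<in>J. x i \<in> A i} y"
    using AE_bern_seq
  proof eventually_elim
    case (elim y)
    have site: "(\<integral>s. e i (g (y i, s)) \<partial>bern d) = indicator (A i) (y i)" for i
    proof -
      have "(\<integral>s. e i (g (y i, s)) \<partial>bern d) = p i + q i * of_real (y i)"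
        using elim \<alpha> by (subst integral_kernel) (auto simp: e_def field_simps)
      then show ?thesis using elim[rule_format, of i] by (auto simp: p_def q_def)
    qed
    have "noise_operator G (bern_seq d) ?f y = (\<Prod>i\<in>J. indicator (A i) (y i))"
      unfolding noise_operator_def by (subst integral_noise_prod[OF J em]) (simp add: site)
    also have "\<dots> = indicator {x. \<forall>i\<in>J. x i \<in> A i} y"
      using J by (auto simp: indicator_def prod_zero_iff)
    finally show ?case .
  qed
qed

lemma noise_dense: "L2_dense_range (bern_seq c) (bern_seq b) (noise_operator G (bern_seq d))"
proof (rule dense_range_if_approximable, rule approximable_L2)
  fix A assume A: "A \<in> sets (bern_seq b)"
  let ?E = "prod_algebra UNIV (\<lambda>_::nat. borel :: real measure)"
  show "approximable (indicator A)"
  proof (rule approximable_indicator[of ?E])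
    show "sets (bern_seq b) = sigma_sets (space (bern_seq b)) ?E"
      by (simp add: sets_PiM PiE_UNIV_domain)
    show "?E \<subseteq> Pow (space (bern_seq b))" by simp
    show "Int_stable ?E" by (rule Int_stable_prod_algebra)
    show "approximable (indicator B)" if B: "B \<in> ?E" for B
    proof -
      from B obtain J E where J: "B = prod_emb UNIV (\<lambda>_. borel) J (Pi\<^sub>E J E)" "finite J"
        "\<And>i. i \<in> J \<Longrightarrow> E i \<in> sets borel"
        by (elim prod_algebraE) auto
      have "B = {x. \<forall>i\<in>J. x i \<in> E i}"
        unfolding J(1) by (auto simp: prod_emb_def PiE_UNIV_domain PiE_iff)
      then show ?thesis using noise_cylinder[OF J(2,3)] by simp
    qed
  qed (fact A)
qed

end

subsection \<open>Bernoulli shifts\<close>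

text \<open>The product topology on real sequences is Polish, and its Borel sets form the product
  \<sigma>-algebra.\<close>

lemma standard_borel_bern_seq: "standard_borel (bern_seq a)"
  unfolding standard_borel_def
proof (intro exI conjI)
  show "second_countable (euclidean :: (nat \<Rightarrow> real) topology)"
  proof -
    obtain B :: "(nat \<Rightarrow> real) set set" where B: "countable B" "topological_basis B"
      using ex_countable_basis by blast
    have "\<exists>W\<in>B. x \<in> W \<and> W \<subseteq> U" if "open U" "x \<in> U" for U x
      by (rule topological_basisE[OF B(2) that]) (rule bexI, rule conjI)
    moreover have "open V" if "V \<in> B" for V
      using B(2) that by (rule topological_basis_open)
    ultimately show ?thesis
      unfolding second_countable_def open_openin[symmetric] using B(1) by (intro exI[of _ B] conjI) simp_all
  qed
  show "sets (bern_seq a) = sigma_sets (space (bern_seq a)) {U. openin euclidean U}"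
    using sets_PiM_equal_borel[where 'a = nat and 'b = real] by (simp add: borel_def)
qed (simp_all add: completely_metrizable_space_euclidean)

text \<open>Coordinates are indexed by the integers through \<^const>\<open>int_encode\<close>.\<close>

definition coord_shift :: "int \<Rightarrow> (nat \<Rightarrow> real) \<Rightarrow> nat \<Rightarrow> real" where
  "coord_shift k x n = x (int_encode (int_decode n + k))"

lemma shift_add: "coord_shift j (coord_shift k x) = coord_shift (j + k) x"
  and shift_0: "coord_shift 0 x = x"
  by (simp_all add: coord_shift_def fun_eq_iff add.assoc)

lemma shift_measurable[measurable]: "coord_shift k \<in> measurable (PiM UNIV (\<lambda>_. borel)) (PiM UNIV (\<lambda>_. borel))"
  unfolding coord_shift_def[abs_def] by (rule measurable_PiM_single') (simp_all add: PiE_UNIV_domain)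

lemma distr_shift: "distr (bern_seq a) (bern_seq a) (coord_shift k) = bern_seq a"
proof -
  have "inj (\<lambda>n. int_encode (int_decode n + k))"
    by (rule injI) (metis add_right_cancel int_encode_inverse int_decode_inverse)
  from distr_PiM_reindex[OF _ this, of UNIV "\<lambda>_. bern a"] show ?thesis
    by (simp add: prob_space_bern bern_seq_def restrict_UNIV coord_shift_def[abs_def])
qed

lemma integral_shift:
  fixes f :: "(nat \<Rightarrow> real) \<Rightarrow> 'e :: {banach, second_countable_topology}"
  assumes "f \<in> borel_measurable (bern_seq a)"
  shows "(\<integral>x. f (coord_shift k x) \<partial>bern_seq a) = (\<integral>x. f x \<partial>bern_seq a)"
  using integral_distr[of "coord_shift k" "bern_seq a" "bern_seq a" f] assms by (simp add: distr_shift)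

lemma measure_shift:
  assumes "A \<in> sets (bern_seq a)"
  shows "measure (bern_seq a) (coord_shift k -` A) = measure (bern_seq a) A"
  using measure_distr[of "coord_shift k" "bern_seq a" "bern_seq a" A] assms by (simp add: distr_shift)

lemma bij_shift: "bij (coord_shift k)"
  by (rule o_bij[of "coord_shift (- k)"]) (simp_all add: fun_eq_iff shift_add shift_0)

lemma automorphism_shift: "automorphism (bern_seq a) (coord_shift k)"
proof -
  have "the_inv_into UNIV (coord_shift k) = coord_shift (- k)"
    using bij_is_inj[OF bij_shift, of k]
    by (intro ext the_inv_into_f_eq) (simp_all add: shift_add shift_0)
  then show ?thesis
    by (simp add: automorphism_def bij_shift distr_shift)
qed

section \<open>Approximation by finitely many coordinates, and ergodicity\<close>

definition determined_by :: "nat set \<Rightarrow> (nat \<Rightarrow> real) set \<Rightarrow> bool" where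
  "determined_by F C \<longleftrightarrow> (\<forall>x y. (\<forall>i\<in>F. x i = y i) \<longrightarrow> (x \<in> C \<longleftrightarrow> y \<in> C))"

text \<open>The first term is the cost of truncating the union, the sum is the cost of replacing the
  members that remain.\<close>

lemma (in finite_measure) measure_sym_diff_Un_le:
  fixes A C :: "nat \<Rightarrow> 'a set"
  assumes [measurable]: "\<And>i. A i \<in> sets M" "\<And>i. C i \<in> sets M"
  shows "measure M (sym_diff (\<Union>i. A i) (\<Union>i<n. C i)) \<le>
    measure M ((\<Union>i. A i) - (\<Union>i<n. A i)) + (\<Sum>i<n. measure M (sym_diff (A i) (C i)))"
proof -
  have "measure M (sym_diff (\<Union>i. A i) (\<Union>i<n. C i)) \<le>
      measure M (((\<Union>i. A i) - (\<Union>i<n. A i)) \<union> (\<Union>i<n. sym_diff (A i) (C i)))"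
  proof (rule finite_measure_mono)
    show "(\<Union>i. A i) - (\<Union>i<n. A i) \<union> (\<Union>i<n. sym_diff (A i) (C i)) \<in> sets M" by measurable
  qed auto
  also have "\<dots> \<le> measure M ((\<Union>i. A i) - (\<Union>i<n. A i)) + measure M (\<Union>i<n. sym_diff (A i) (C i))"
    by (rule measure_Un_le) measurable
  also have "measure M (\<Union>i<n. sym_diff (A i) (C i)) \<le> (\<Sum>i<n. measure M (sym_diff (A i) (C i)))"
    by (rule measure_UNION_le) auto
  finally show ?thesis by simp
qed

text \<open>Induction over the generation of the \<sigma>-algebra from one-coordinate sets. The
  tolerance stays arbitrary, because a union spends half of it on truncation and splits the other
  half among finitely many members.\<close>

lemma approx_by_determined:
  assumes "A \<in> sets (bern_seq a)" "0 < \<delta>"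
  shows "\<exists>F C. finite F \<and> C \<in> sets (bern_seq a) \<and> determined_by F C \<and>
    measure (bern_seq a) (sym_diff A C) < \<delta>"
proof -
  interpret prob_space "bern_seq a" by (rule prob_space_bern_seq)
  have S: "sets (bern_seq a) =
      sigma_sets (\<Pi>\<^sub>E i\<in>UNIV. space borel) {{f\<in>\<Pi>\<^sub>E i\<in>UNIV. space borel. f i \<in> A} | (i :: nat) A. i \<in> UNIV \<and> A \<in> sets (borel :: real measure)}"
    using sets_PiM_single[of UNIV "\<lambda>_::nat. borel :: real measure"] by simp
  from assms(1)[unfolded S] assms(2) show ?thesis
  proof (induction arbitrary: \<delta>)
    case (Basic A)
    then obtain i B where A: "A = {f. f i \<in> B}" "B \<in> sets borel" by (auto simp: PiE_UNIV_domain)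
    have "A \<in> sets (bern_seq a)" unfolding S by (rule sigma_sets.Basic) fact
    moreover have "determined_by {i} A" by (auto simp: A determined_by_def)
    ultimately show ?case using Basic by (intro exI[of _ "{i}"] exI[of _ A]) auto
  next
    case Empty
    then show ?case by (intro exI[of _ "{}"]) (auto simp: determined_by_def)
  next
    case (Compl A)
    then obtain F C where F: "finite F" "C \<in> sets (bern_seq a)" "determined_by F C"
      "measure (bern_seq a) (sym_diff A C) < \<delta>" by blast
    have "sym_diff (UNIV - A) (UNIV - C) = sym_diff A C" by auto
    moreover have "UNIV - C \<in> sets (bern_seq a)" using sets.compl_sets[OF F(2)] by simp
    moreover have "determined_by F (UNIV - C)" using F(3) by (auto simp: determined_by_def)
    ultimately show ?case using F by (intro exI[of _ F] exI[of _ "UNIV - C"]) (simp add: PiE_UNIV_domain)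
  next
    case (Union A)
    have A[measurable]: "A i \<in> sets (bern_seq a)" for i unfolding S by (rule Union.hyps)
    have "(\<lambda>n. measure (bern_seq a) (\<Union>i<n. A i)) \<longlonglongrightarrow> measure (bern_seq a) (\<Union>n. \<Union>i<n. A i)"
      by (rule finite_Lim_measure_incseq) (use A in \<open>auto simp: incseq_def intro: less_le_trans\<close>)
    moreover have "(\<Union>n. \<Union>i<n. A i) = (\<Union>i. A i)" by auto
    ultimately have "eventually (\<lambda>n. measure (bern_seq a) (\<Union>i. A i) - \<delta> / 2 < measure (bern_seq a) (\<Union>i<n. A i)) sequentially"
      using Union.prems by (intro order_tendstoD) auto
    then obtain n where "measure (bern_seq a) (\<Union>i. A i) - \<delta> / 2 < measure (bern_seq a) (\<Union>i<n. A i)"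
      by (auto simp: eventually_sequentially)
    moreover have "measure (bern_seq a) ((\<Union>i. A i) - (\<Union>i<n. A i)) =
        measure (bern_seq a) (\<Union>i. A i) - measure (bern_seq a) (\<Union>i<n. A i)"
      by (rule finite_measure_Diff) (measurable, auto)
    ultimately have n: "measure (bern_seq a) ((\<Union>i. A i) - (\<Union>i<n. A i)) < \<delta> / 2" by simp
    \<comment> \<open>The \<open>+ 1\<close> covers the case \<open>n = 0\<close>.\<close>
    have "0 < \<delta> / (2 * (real n + 1))" using Union.prems by simp
    then have "\<forall>i. \<exists>F C. finite F \<and> C \<in> sets (bern_seq a) \<and> determined_by F C \<and>
        measure (bern_seq a) (sym_diff (A i) C) < \<delta> / (2 * (real n + 1))"
      using Union.IH by blast
    then obtain F C where F: "\<And>i. finite (F i)" and C[measurable]: "\<And>i. C i \<in> sets (bern_seq a)"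
      and FC: "\<And>i. determined_by (F i) (C i)"
      "\<And>i. measure (bern_seq a) (sym_diff (A i) (C i)) < \<delta> / (2 * (real n + 1))"
      by metis
    have "(\<Sum>i<n. measure (bern_seq a) (sym_diff (A i) (C i))) \<le> real n * (\<delta> / (2 * (real n + 1)))"
      using sum_bounded_above[of "{..<n}" "\<lambda>i. measure (bern_seq a) (sym_diff (A i) (C i))", OF less_imp_le[OF FC(2)]] by simp
    also have "\<dots> \<le> \<delta> / 2" using Union.prems by (simp add: field_simps)
    finally have "measure (bern_seq a) (sym_diff (\<Union>i. A i) (\<Union>i<n. C i)) < \<delta>"
      using measure_sym_diff_Un_le[of A C n] A C n by simp
    moreover have "determined_by (\<Union>i<n. F i) (\<Union>i<n. C i)"
      using FC(1) unfolding determined_by_def by (simp add: Bex_def) (metis lessThan_iff)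
    moreover have "(\<Union>i<n. C i) \<in> sets (bern_seq a)" by measurable
    ultimately show ?case using F by (intro exI[of _ "\<Union>i<n. F i"] exI[of _ "\<Union>i<n. C i"]) simp
  qed
qed

lemma measure_Int_determined:
  assumes C: "C \<in> sets (bern_seq a)" "determined_by F C" and D: "D \<in> sets (bern_seq a)" "determined_by F' D"
    and disj: "F \<inter> F' = {}"
  shows "measure (bern_seq a) (C \<inter> D) = measure (bern_seq a) C * measure (bern_seq a) D"
proof -
  interpret prob_space "bern_seq a" by (rule prob_space_bern_seq)
  have ind: "indep_var (PiM F (\<lambda>_. borel)) (\<lambda>x. restrict x F) (PiM F' (\<lambda>_. borel)) (\<lambda>x. restrict x F')"
    using indep_var_restrict[OF indep_vars_bern_seq disj] by simp
  have pre: "\<exists>C'\<in>sets (PiM F (\<lambda>_. borel)). C = (\<lambda>x. restrict x F) -` C'"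
    if C: "C \<in> sets (bern_seq a)" "determined_by F C" for F C
  proof -
    \<comment> \<open>Coordinates outside \<open>F\<close> receive the default 0; a set determined
      by \<open>F\<close> does not see this.\<close>
    let ?e = "\<lambda>z i. if i \<in> F then z i else 0"
    have e: "?e \<in> measurable (PiM F (\<lambda>_. borel)) (PiM UNIV (\<lambda>_. borel :: real measure))"
    proof (rule measurable_PiM_single')
      show "(\<lambda>z. if i \<in> F then z i else 0) \<in> borel_measurable (PiM F (\<lambda>_. borel))" for i
        by (cases "i \<in> F") auto
    qed (auto simp: PiE_UNIV_domain)
    let ?C = "?e -` C \<inter> space (PiM F (\<lambda>_. borel))"
    have "?C \<in> sets (PiM F (\<lambda>_. borel))"
      using C(1) by (intro measurable_sets[OF e]) simp
    moreover have "C = (\<lambda>x. restrict x F) -` ?C"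
    proof (rule set_eqI)
      fix x
      have "x \<in> C \<longleftrightarrow> ?e (restrict x F) \<in> C"
        using C(2) unfolding determined_by_def by simp
      then show "x \<in> C \<longleftrightarrow> x \<in> (\<lambda>x. restrict x F) -` ?C" by (simp add: space_PiM)
    qed
    ultimately show ?thesis by blast
  qed
  obtain C' where C': "C' \<in> sets (PiM F (\<lambda>_. borel))" "C = (\<lambda>x. restrict x F) -` C'" using pre[OF C] by blast
  obtain D' where D': "D' \<in> sets (PiM F' (\<lambda>_. borel))" "D = (\<lambda>x. restrict x F') -` D'" using pre[OF D] by blast
  have "C \<inter> D = (\<lambda>x. (restrict x F, restrict x F')) -` (C' \<times> D')" by (auto simp: C' D')
  then show ?thesis using indep_varD[OF ind C'(1) D'(1)] by (simp add: C'(2) D'(2))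
qed

lemma determined_by_shift:
  "determined_by F C \<Longrightarrow> determined_by ((\<lambda>n. int_encode (int_decode n + k)) ` F) (coord_shift k -` C)"
  unfolding determined_by_def by (auto simp: coord_shift_def)

text \<open>A mixing argument: an invariant \<open>A\<close> is close to a set \<open>C\<close> of
  finitely many coordinates and, by invariance, to every shift of \<open>C\<close>. A distant shift
  of \<open>C\<close> is independent of \<open>C\<close>, so \<open>prob A\<close> is arbitrarily
  close to its own square.\<close>

lemma ergodic_shift: "ergodic (bern_seq a) (coord_shift 1)"
  unfolding ergodic_def
proof (intro ballI impI)
  interpret prob_space "bern_seq a" by (rule prob_space_bern_seq)
  fix A assume A[measurable]: "A \<in> sets (bern_seq a)" and inv: "coord_shift 1 -` A \<inter> space (bern_seq a) = A"
  have inv': "coord_shift (int n) -` A = A" for n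
  proof (induction n)
    case (Suc n)
    have "coord_shift (int (Suc n)) -` A = coord_shift (int n) -` (coord_shift 1 -` A)"
      by (auto simp: shift_add)
    then show ?case using inv Suc by simp
  qed (auto simp: shift_0)
  have *: "\<bar>prob A - prob A * prob A\<bar> \<le> \<delta>" if "0 < \<delta>" for \<delta>
  proof -
    obtain F C where F: "finite F" and C[measurable]: "C \<in> sets (bern_seq a)" and dC: "determined_by F C"
      and AC: "prob (sym_diff A C) < \<delta> / 4"
      using approx_by_determined[OF A, of "\<delta> / 4"] \<open>0 < \<delta>\<close> by auto
    \<comment> \<open>One more than the spread of the coordinates, so that \<open>F\<close> and its
      translate are disjoint. Inserting 0 makes \<open>Max\<close> and \<open>Min\<close> meaningful
      for empty \<open>F\<close>.\<close>
    define N where "N = nat (Max (insert 0 (int_decode ` F)) - Min (insert 0 (int_decode ` F)) + 1)"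
    have N: "int_decode i + int N > int_decode j" if "i \<in> F" "j \<in> F" for i j
    proof -
      have "int_decode j \<le> Max (insert 0 (int_decode ` F))" "Min (insert 0 (int_decode ` F)) \<le> int_decode i"
        using F that by auto
      then show ?thesis unfolding N_def by linarith
    qed
    let ?F = "(\<lambda>n. int_encode (int_decode n + int N)) ` F"
    let ?D = "coord_shift (int N) -` C"
    have D[measurable]: "?D \<in> sets (bern_seq a)"
      using measurable_sets[of "coord_shift (int N)" "bern_seq a" "bern_seq a" C] C by simp
    have "F \<inter> ?F = {}" using N by (auto simp: set_eq_iff) (metis int_encode_inverse less_irrefl)
    then have CD: "prob (C \<inter> ?D) = prob C * prob C"
      using measure_Int_determined[OF C dC D determined_by_shift[OF dC]] measure_shift[OF C] by simp
    have ACs: "sym_diff A C \<in> sets (bern_seq a)" by measurable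
    have "sym_diff A ?D = coord_shift (int N) -` sym_diff A C" using inv'[of N] by auto
    then have AD: "prob (sym_diff A ?D) < \<delta> / 4"
      using measure_shift[OF ACs, of "int N"] AC by simp
    have d: "\<bar>prob X - prob Y\<bar> \<le> prob (sym_diff X Y)" if [measurable]: "X \<in> events" "Y \<in> events" for X Y
    proof -
      have "prob X \<le> prob (Y \<union> sym_diff X Y)" "prob Y \<le> prob (X \<union> sym_diff X Y)"
        by (rule finite_measure_mono, blast, measurable)+
      moreover have "prob (Y \<union> sym_diff X Y) \<le> prob Y + prob (sym_diff X Y)"
        "prob (X \<union> sym_diff X Y) \<le> prob X + prob (sym_diff X Y)"
        by (rule measure_Un_le; measurable)+
      ultimately show ?thesis by linarith
    qed
    have "prob (sym_diff A (C \<inter> ?D)) \<le> prob (sym_diff A C \<union> sym_diff A ?D)"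
      by (rule finite_measure_mono, blast, measurable)
    also have "\<dots> \<le> prob (sym_diff A C) + prob (sym_diff A ?D)"
      by (rule measure_Un_le) measurable
    finally have 1: "\<bar>prob A - prob C * prob C\<bar> \<le> \<delta> / 2"
      using d[OF A sets.Int[OF C D]] AC AD CD by simp
    have 2: "\<bar>prob A - prob C\<bar> \<le> \<delta> / 4" using d[OF A C] AC by simp
    have "\<bar>prob A * prob A - prob C * prob C\<bar> = \<bar>prob A - prob C\<bar> * (prob A + prob C)"
      using measure_nonneg[of "bern_seq a" A] measure_nonneg[of "bern_seq a" C]
      by (simp add: square_diff_square_factored abs_mult)
    also have "\<dots> \<le> \<delta> / 4 * 2"
    proof (intro mult_mono 2)
      show "prob A + prob C \<le> 2" using prob_le_1[of A] prob_le_1[of C] by linarith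
    qed (use \<open>0 < \<delta>\<close> in simp_all)
    finally show ?thesis using 1 by linarith
  qed
  have "\<bar>prob A - prob A * prob A\<bar> \<le> 0"
    by (rule field_le_epsilon) (use * in simp)
  then have "prob A * (1 - prob A) = 0" by (simp add: right_diff_distrib)
  then show "prob A = 0 \<or> prob A = 1" by auto
qed

text \<open>\<open>G\<close> acts site by site, so shifting its output amounts to shifting both
  \<open>y\<close> and the noise; the shift of the noise vanishes on integration, as the law of the
  noise is invariant.\<close>

lemma (in bern_kernel) markov_quasi_image:
  "markov_quasi_image (bern_seq c) (coord_shift k) (bern_seq b) (coord_shift k)"
proof -
  have "noise_operator G (bern_seq d) (koopman (coord_shift k) f) y = koopman (coord_shift k) (noise_operator G (bern_seq d) f) y"
    if f: "f \<in> L2 (bern_seq c)" for f y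
  proof -
    have [measurable]: "f \<in> borel_measurable (bern_seq c)" using f by (simp add: L2_def)
    note [measurable] = G_measurable
    have "(\<lambda>u. f (G (coord_shift k y, u))) \<in> borel_measurable (bern_seq d)" by simp
    moreover have "coord_shift k (G (y, u)) = G (coord_shift k y, coord_shift k u)" for u
      by (simp add: fun_eq_iff coord_shift_def G_def)
    ultimately show ?thesis
      unfolding noise_operator_def koopman_def o_def
      by (simp add: integral_shift[of "\<lambda>u. f (G (coord_shift k y, u))"])
  qed
  then show ?thesis
    unfolding markov_quasi_image_def using noise_markov noise_dense by (intro exI conjI) auto
qed

text \<open>The kernel multiplies bits: a one survives with probability \<open>d\<close>, so the
  slope is \<open>d\<close>.\<close>

lemma markov_quasi_image_thin:
  assumes "0 \<le> b" "b \<le> 1" "0 < d" "d \<le> 1"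
  shows "markov_quasi_image (bern_seq (b * d)) (coord_shift k) (bern_seq b) (coord_shift k)"
proof -
  interpret bern_kernel b "b * d" d d 0 "\<lambda>(t, s). t * s"
    using assms by unfold_locales (auto simp: case_prod_beta intro!: borel_measurable_continuous_onI continuous_intros)
  show ?thesis by (rule markov_quasi_image)
qed

text \<open>The kernel takes the maximum of two bits, written as a polynomial. Given
  \<open>t\<close>, the result is 1 with probability \<open>d + (1 - d) * t\<close>, whose slope is
  nonzero because \<open>d < 1\<close>.\<close>

lemma markov_quasi_image_thicken:
  assumes "0 \<le> b" "b \<le> 1" "0 \<le> d" "d < 1"
  shows "markov_quasi_image (bern_seq (b + d - b * d)) (coord_shift k) (bern_seq b) (coord_shift k)"
proof -
  interpret bern_kernel b "b + d - b * d" d "1 - d" d "\<lambda>(t, s). t + s - t * s"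
    using assms by unfold_locales (auto simp: case_prod_beta algebra_simps intro!: borel_measurable_continuous_onI continuous_intros)
  show ?thesis by (rule markov_quasi_image)
qed

subsection \<open>The entropy obstruction\<close>

text \<open>Exponential weights: if \<open>T\<close> weighs 1/16 to the power \<open>card T\<close>,
  each small subset weighs at least (1/16)^l, while all subsets together weigh (17/16)^(16 l). Per
  block of 16 elements this leaves 16 * (17/16)^16, about 42.2.\<close>

lemma card_small_subsets_le:
  assumes S: "finite S" "card S = 16 * l"
  shows "card {T. T \<subseteq> S \<and> 16 * card T \<le> card S} \<le> 44 ^ l"
proof -
  let ?\<T> = "{T. T \<subseteq> S \<and> 16 * card T \<le> card S}"
  have fin: "finite (Pow S)" using S by simp
  have "real (card ?\<T>) * (1 / 16) ^ l = (\<Sum>T\<in>?\<T>. (1 / 16 :: real) ^ l)" by simp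
  also have "\<dots> \<le> (\<Sum>T\<in>?\<T>. (1 / 16) ^ card T)"
    using S by (intro sum_mono power_decreasing) auto
  also have "\<dots> \<le> (\<Sum>T\<in>Pow S. (1 / 16) ^ card T)"
    using fin by (intro sum_mono2) auto
  also have "\<dots> = (1 / 16 + 1) ^ card S"
    using prod_add[OF S(1), of "\<lambda>_. 1 / 16 :: real" "\<lambda>_. 1"] by simp
  finally have "real (card ?\<T>) * (1 / 16) ^ l \<le> ((17 / 16) ^ 16) ^ l"
    unfolding S(2) power_mult by simp
  then have "16 ^ l * (real (card ?\<T>) * (1 / 16) ^ l) \<le> 16 ^ l * ((17 / 16) ^ 16) ^ l"
    by (rule mult_left_mono) simp
  moreover have "16 ^ l * (real (card ?\<T>) * (1 / 16) ^ l) = real (card ?\<T>)"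
    by (simp add: power_one_over)
  ultimately have "real (card ?\<T>) \<le> 16 ^ l * ((17 / 16) ^ 16) ^ l" by linarith
  also have "\<dots> = (16 * (17 / 16) ^ 16) ^ l" by (simp only: power_mult_distrib)
  also have "\<dots> \<le> 44 ^ l"
  proof (rule power_mono)
    show "16 * (17 / 16) ^ 16 \<le> (44 :: real)" by (simp only: power_divide) simp
  qed simp
  also have "\<dots> = real (44 ^ l)" by simp
  finally show ?thesis by (simp only: of_nat_le_iff)
qed

lemma card_eq_sum_indicator:
  "finite I \<Longrightarrow> real (card {i\<in>I. x \<in> E i}) = (\<Sum>i\<in>I. indicator (E i) x)"
  by (simp add: indicator_def sum.If_cases Int_def)

text \<open>Markov's inequality for the number of events that occur. It asks for no independence and
  so also covers coding errors, whose windows may overlap.\<close>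

lemma (in prob_space) prob_many_events_le:
  fixes r p :: real
  assumes I: "finite I" "I \<noteq> {}" and E: "\<And>i. i \<in> I \<Longrightarrow> E i \<in> events" and p: "\<And>i. i \<in> I \<Longrightarrow> prob (E i) \<le> p"
    and r: "0 < r"
  shows "prob {x\<in>space M. card I \<le> r * card {i\<in>I. x \<in> E i}} \<le> r * p"
proof -
  let ?N = "\<lambda>x. \<Sum>i\<in>I. indicator (E i) x :: real"
  have N: "?N x = card {i\<in>I. x \<in> E i}" for x
    by (rule card_eq_sum_indicator[OF I(1), symmetric])
  have cI: "0 < real (card I)" using I by (simp add: card_gt_0_iff)
  have int: "integrable M (\<lambda>x. indicator (E i) x :: real)" if "i \<in> I" for i
    using E[OF that] by (simp add: emeasure_eq_measure)
  have "prob {x\<in>space M. card I \<le> r * card {i\<in>I. x \<in> E i}} = prob {x\<in>space M. ?N x \<ge> card I / r}"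
    unfolding N using r by (simp add: field_simps)
  also have "\<dots> \<le> expectation ?N / (card I / r)"
    using r cI by (intro integral_Markov_inequality_measure[where A = "{}"] Bochner_Integration.integrable_sum int)
      (auto intro!: sum_nonneg)
  also have "expectation ?N = (\<Sum>i\<in>I. prob (E i))"
    using int E by (simp add: Bochner_Integration.integral_sum)
  also have "\<dots> \<le> card I * p"
    using sum_bounded_above[of I "\<lambda>i. prob (E i)" p] p by simp
  finally show ?thesis using r cI by (simp add: divide_right_mono field_simps)
qed

lemma measure_bern_seq_word:
  assumes "w \<subseteq> {..<n}"
  shows "measure (bern_seq (1 / 2)) {y. {m. m < n \<and> y (int_encode (int m)) = 1} = w} = (1 / 2) ^ n"
proof -
  interpret product_prob_space "\<lambda>_. bern (1 / 2)" UNIV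
    by (auto simp: product_prob_space_def product_prob_space_axioms_def product_sigma_finite_def
        prob_space_bern prob_space_imp_sigma_finite)
  let ?e = "\<lambda>m. int_encode (int m)"
  \<comment> \<open>A word is the set of positions of its ones. The other letter is represented by
    the complement of \<open>{1}\<close>, so the two classes partition the line and no null set has
    to be removed.\<close>
  let ?X = "\<lambda>i. if i \<in> ?e ` w then {1 :: real} else - {1}"
  have inj: "inj_on ?e A" for A by (simp add: inj_on_def int_encode_eq)
  have half: "emeasure (bern (1 / 2)) (?X i) = ennreal (1 / 2)" for i
  proof -
    have "measure (bern (1 / 2)) (?X i) = (\<integral>t. indicator (?X i) t \<partial>bern (1 / 2))" by simp
    also have "\<dots> = 1 / 2" by (subst integral_bern) auto
    finally show ?thesis by (simp only: M.emeasure_eq_measure)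
  qed
  have mem: "?e m \<in> ?e ` w \<longleftrightarrow> m \<in> w" for m by (auto simp: int_encode_eq)
  have "{y. {m. m < n \<and> y (?e m) = 1} = w} = {y \<in> space (PiM UNIV (\<lambda>_. bern (1 / 2))). \<forall>i\<in>?e ` {..<n}. y i \<in> ?X i}"
    using assms by (auto simp: space_PiM PiE_UNIV_domain mem split: if_splits)
  then have "emeasure (bern_seq (1 / 2)) {y. {m. m < n \<and> y (?e m) = 1} = w} = (\<Prod>i\<in>?e ` {..<n}. emeasure (bern (1 / 2)) (?X i))"
    unfolding bern_seq_def by (simp only:) (rule emeasure_PiM_Collect, auto)
  also have "\<dots> = ennreal (1 / 2) ^ n" by (simp only: half) (simp add: card_image inj)
  also have "\<dots> = ennreal ((1 / 2) ^ n)" by (rule ennreal_power) simp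
  finally show ?thesis by (simp add: measure_def)
qed

text \<open>
  A factor map is approximated by a block code, so with large probability the first \<open>n = 16 * l\<close>
  symbols of the image are, up to few errors, a function of a source word of length
  \<open>n + 16 * k\<close> with few ones. There are at most \<open>44 ^ (k + l)\<close> such words and \<open>44 ^ l\<close> sets of errors,
  while each of the \<open>2 ^ n = 65536 ^ l\<close> image words has the same probability.
\<close>

lemma not_factor_of_fair: "\<not> factor_of (bern_seq (1 / 64)) (coord_shift 1) (bern_seq (1 / 2)) (coord_shift 1)"
proof
  let ?P = "bern_seq (1 / 64)" and ?Q = "bern_seq (1 / 2)" and ?e = "\<lambda>m. int_encode (int m)"
  interpret prob_space ?P by (rule prob_space_bern_seq)
  assume "factor_of ?P (coord_shift 1) ?Q (coord_shift 1)"
  then obtain \<pi> where \<pi>[measurable]: "\<pi> \<in> measurable ?P ?Q" and d\<pi>: "distr ?P ?Q \<pi> = ?Q"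
    and eq: "AE x in ?P. \<pi> (coord_shift 1 x) = coord_shift 1 (\<pi> x)"
    unfolding factor_of_def by blast
  \<comment> \<open>The time-zero symbol of the image; its shifts give all symbols of the image at
    non-negative times.\<close>
  define A where "A = {x. \<pi> x (?e 0) = 1}"
  have A[measurable]: "A \<in> sets ?P"
  proof -
    have "{x \<in> space ?P. \<pi> x (?e 0) = 1} \<in> sets ?P"
      using measurable_compose[OF \<pi>, of "\<lambda>y. y (?e 0)" borel] by measurable
    then show ?thesis by (simp add: A_def)
  qed
  have eqm: "AE x in ?P. \<pi> (coord_shift (int m) x) = coord_shift (int m) (\<pi> x)" for m
  proof (induction m)
    case (Suc m)
    \<comment> \<open>The exceptional set moves along with the shift and stays null because the
      measure is invariant.\<close>
    have "AE x in distr ?P ?P (coord_shift (int m)). \<pi> (coord_shift 1 x) = coord_shift 1 (\<pi> x)"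
      using eq by (simp only: distr_shift)
    then have "AE x in ?P. \<pi> (coord_shift 1 (coord_shift (int m) x)) = coord_shift 1 (\<pi> (coord_shift (int m) x))"
      by (rule AE_distrD[rotated]) simp
    with Suc show ?case by eventually_elim (simp add: shift_add)
  qed (simp add: shift_0)
  have word: "AE x in ?P. \<forall>m. coord_shift (int m) x \<in> A \<longleftrightarrow> \<pi> x (?e m) = 1"
    unfolding AE_all_countable
  proof
    show "AE x in ?P. coord_shift (int m) x \<in> A \<longleftrightarrow> \<pi> x (?e m) = 1" for m
      using eqm[of m] by eventually_elim (simp add: A_def coord_shift_def)
  qed
  \<comment> \<open>With an expected error density below 1/128, a density of 1/16 is reached with
    probability at most 16/128 = 1/8.\<close>
  obtain F C where F: "finite F" and C[measurable]: "C \<in> sets ?P" and FC: "determined_by F C"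
    and AC: "prob (sym_diff A C) < 1 / 128"
    using approx_by_determined[OF A, of "1 / 128"] by auto
  \<comment> \<open>Padding the coding window to \<open>8 * k\<close> on either side makes the
    length of source words divisible by 16, as \<open>card_small_subsets_le\<close> requires.
    \<open>k\<close> is fixed before \<open>l\<close>.\<close>
  obtain k :: nat where k: "\<And>i. i \<in> F \<Longrightarrow> - (8 * int k) \<le> int_decode i \<and> int_decode i < 8 * int k"
  proof
    define k where "k = nat (Max (insert 0 ((\<lambda>i. \<bar>int_decode i\<bar>) ` F)) + 1)"
    show "- (8 * int k) \<le> int_decode i \<and> int_decode i < 8 * int k" if "i \<in> F" for i
    proof -
      have "\<bar>int_decode i\<bar> \<le> Max (insert 0 ((\<lambda>i. \<bar>int_decode i\<bar>) ` F))" using F that by auto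
      then show ?thesis unfolding k_def by linarith
    qed
  qed
  have bound: "65536 ^ l \<le> 2 * (44 ^ (k + l) * 44 ^ l :: real)" if "0 < l" for l :: nat
  proof -
    define n where "n = 16 * l"
    define J where "J = int_encode ` {- (8 * int k)..<8 * int k + int n}"
    have J: "finite J" "card J = 16 * (k + l)"
      unfolding J_def n_def by (simp_all add: card_image inj_int_encode)
    define source where "source x = {i \<in> J. x i = 1}" for x :: "nat \<Rightarrow> real"
    define errors where "errors x = {m \<in> {..<n}. x \<in> coord_shift (int m) -` sym_diff A C}" for x
    \<comment> \<open>The word \<open>S\<close> is extended by zeros. For \<open>m < n\<close> the
      shifted code looks only at coordinates in \<open>J\<close>, where
      \<open>indicator (source x)\<close> agrees with almost every \<open>x\<close>.\<close>
    define code where "code S = {m. m < n \<and> coord_shift (int m) (indicator S) \<in> C}" for S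
    define image where "image x = {m. m < n \<and> \<pi> x (?e m) = 1}" for x
    define W where "W = (\<lambda>(S, R). sym_diff (code S) R) `
      ({S. S \<subseteq> J \<and> 16 * card S \<le> card J} \<times> {R. R \<subseteq> {..<n} \<and> 16 * card R \<le> card {..<n}})"
    have W: "finite W" "card W \<le> 44 ^ (k + l) * 44 ^ l"
    proof -
      have fin: "finite {S. S \<subseteq> J \<and> 16 * card S \<le> card J}" "finite {R. R \<subseteq> {..<n} \<and> 16 * card R \<le> card {..<n}}"
        using J by auto
      then show "finite W" unfolding W_def by auto
      have "card W \<le> card {S. S \<subseteq> J \<and> 16 * card S \<le> card J} * card {R. R \<subseteq> {..<n} \<and> 16 * card R \<le> card {..<n}}"
        unfolding W_def using card_image_le[OF finite_cartesian_product[OF fin]] by (simp only: card_cartesian_product)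
      also have "\<dots> \<le> 44 ^ (k + l) * 44 ^ l"
        using J by (intro mult_mono card_small_subsets_le) (auto simp: n_def)
      finally show "card W \<le> 44 ^ (k + l) * 44 ^ l" .
    qed
    have W_sub: "w \<subseteq> {..<n}" if "w \<in> W" for w
      using that unfolding W_def code_def by auto
    have one_ev[measurable]: "{x. x i = 1} \<in> sets ?P" for i
    proof -
      have "{x \<in> space ?P. x i = 1} \<in> sets ?P" by measurable
      then show ?thesis by simp
    qed
    have S_le: "prob {x \<in> space ?P. card J \<le> 16 * real (card (source x))} \<le> 16 * (1 / 64)"
    proof -
      have "prob {x. x i = 1} = 1 / 64" for i
      proof -
        have "{x. x i = 1} = (\<lambda>x. x i) -` {1} \<inter> space ?P" by auto
        then have "prob {x. x i = 1} = measure (distr ?P borel (\<lambda>x. x i)) {1}"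
          by (subst measure_distr) auto
        also have "\<dots> = (\<integral>t. indicator {1} t \<partial>bern (1 / 64))" by (simp add: distr_bern_seq_component)
        also have "\<dots> = 1 / 64" by (subst integral_bern) auto
        finally show ?thesis .
      qed
      then have "prob {x\<in>space ?P. card J \<le> 16 * real (card {i\<in>J. x \<in> {x. x i = 1}})} \<le> 16 * (1 / 64)"
        using J \<open>0 < l\<close> one_ev by (intro prob_many_events_le) auto
      then show ?thesis by (simp add: source_def)
    qed
    have AC_s: "sym_diff A C \<in> sets ?P" by measurable
    have ev: "coord_shift (int m) -` sym_diff A C \<in> sets ?P" for m
      using measurable_sets[of "coord_shift (int m)" ?P ?P "sym_diff A C"] AC_s by simp
    have E_le: "prob {x \<in> space ?P. card {..<n} \<le> 16 * real (card (errors x))} \<le> 16 * (1 / 128)"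
      unfolding errors_def
    proof (rule prob_many_events_le)
      show "prob (coord_shift (int m) -` sym_diff A C) \<le> 1 / 128" for m
        using measure_shift[OF AC_s, of "int m"] AC by simp
    qed (use ev \<open>0 < l\<close> in \<open>simp_all add: n_def lessThan_empty_iff\<close>)
    have imW: "AE x in ?P. 16 * card (source x) \<le> card J \<and> 16 * card (errors x) \<le> card {..<n} \<longrightarrow> image x \<in> W"
      using word AE_bern_seq
    proof eventually_elim
      case (elim x)
      have "coord_shift (int m) x \<in> C \<longleftrightarrow> coord_shift (int m) (indicator (source x)) \<in> C" if "m < n" for m
      proof -
        have "coord_shift (int m) x i = coord_shift (int m) (indicator (source x)) i" if "i \<in> F" for i
        proof -
          have "int_encode (int_decode i + int m) \<in> J"
            unfolding J_def using k[OF that] \<open>m < n\<close> by auto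
          then show ?thesis using elim(2) by (auto simp: coord_shift_def source_def indicator_def)
        qed
        then show ?thesis using FC unfolding determined_by_def by blast
      qed
      then have "code (source x) = {m. m < n \<and> coord_shift (int m) x \<in> C}" by (auto simp: code_def)
      \<comment> \<open>The true symbol and the code disagree exactly at the error positions, so
        flipping those recovers the image word.\<close>
      then have "image x = sym_diff (code (source x)) (errors x)"
        using elim(1) by (auto simp: image_def errors_def)
      moreover have "source x \<subseteq> J" "errors x \<subseteq> {..<n}" by (auto simp: source_def errors_def)
      ultimately show ?case unfolding W_def by (auto intro!: image_eqI[of _ _ "(source x, errors x)"])
    qed
    have im_w: "{x. image x = w} \<in> sets ?P" "prob {x. image x = w} = (1 / 2) ^ n" if "w \<in> W" for w
    proof -
      let ?Y = "{y. {m. m < n \<and> y (?e m) = 1} = w}"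
      have "{y \<in> space ?Q. \<forall>m<n. y (?e m) = 1 \<longleftrightarrow> m \<in> w} \<in> sets ?Q" by measurable
      also have "{y \<in> space ?Q. \<forall>m<n. y (?e m) = 1 \<longleftrightarrow> m \<in> w} = ?Y"
        using W_sub[OF that] by auto
      finally have Y: "?Y \<in> sets ?Q" .
      have im: "{x. image x = w} = \<pi> -` ?Y \<inter> space ?P" by (auto simp: image_def)
      show "{x. image x = w} \<in> sets ?P" unfolding im by (rule measurable_sets[OF \<pi> Y])
      have "prob {x. image x = w} = measure (distr ?P ?Q \<pi>) ?Y"
        unfolding im by (rule measure_distr[OF \<pi> Y, symmetric])
      then show "prob {x. image x = w} = (1 / 2) ^ n"
        by (simp only: d\<pi> measure_bern_seq_word[OF W_sub[OF that]])
    qed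
    have S_ev: "{x \<in> space ?P. card J \<le> 16 * real (card (source x))} \<in> sets ?P" (is "?S \<in> _")
    proof -
      have "real (card (source x)) = (\<Sum>i\<in>J. indicator {x. x i = 1} x)" for x
        unfolding source_def using card_eq_sum_indicator[OF J(1), of x "\<lambda>i. {x. x i = 1}"] by simp
      then show ?thesis by (simp only:) measurable
    qed
    have E_ev: "{x \<in> space ?P. card {..<n} \<le> 16 * real (card (errors x))} \<in> sets ?P" (is "?E \<in> _")
    proof -
      note ev[measurable]
      have "real (card (errors x)) = (\<Sum>m\<in>{..<n}. indicator (coord_shift (int m) -` sym_diff A C) x)" for x
        unfolding errors_def by (rule card_eq_sum_indicator) simp
      then show ?thesis by (simp only:) measurable
    qed
    have Un_ev: "(\<Union>w\<in>W. {x. image x = w}) \<in> sets ?P" using W(1) im_w(1) by auto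
    have "1 = prob (space ?P)" by (rule prob_space[symmetric])
    also have "\<dots> \<le> prob (?S \<union> ?E \<union> (\<Union>w\<in>W. {x. image x = w}))"
    proof (rule finite_measure_mono_AE)
      show "AE x in ?P. x \<in> space ?P \<longrightarrow> x \<in> ?S \<union> ?E \<union> (\<Union>w\<in>W. {x. image x = w})"
        using imW by eventually_elim (auto simp: not_le simp flip: of_nat_mult of_nat_less_iff)
    qed (use S_ev E_ev Un_ev in auto)
    also have "\<dots> \<le> prob (?S \<union> ?E) + prob (\<Union>w\<in>W. {x. image x = w})"
      using S_ev E_ev Un_ev by (intro measure_Un_le) auto
    also have "prob (?S \<union> ?E) \<le> prob ?S + prob ?E"
      using S_ev E_ev by (intro measure_Un_le)
    also have "prob (\<Union>w\<in>W. {x. image x = w}) \<le> (\<Sum>w\<in>W. prob {x. image x = w})"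
      using W(1) im_w(1) by (rule measure_UNION_le)
    also have "\<dots> = card W * (1 / 2) ^ n" using im_w(2) by simp
    \<comment> \<open>The two exceptional events have total probability at most 1/4 + 1/8, below
      1/2.\<close>
    finally have "1 / 2 \<le> card W * (1 / 2 :: real) ^ n" using S_le E_le by linarith
    also have "\<dots> \<le> real (44 ^ (k + l) * 44 ^ l) * (1 / 2) ^ n"
      using W(2) by (intro mult_right_mono) (simp_all only: of_nat_le_iff, simp)
    finally have "2 ^ n \<le> 2 * (44 ^ (k + l) * 44 ^ l :: real)"
      by (simp add: power_divide field_simps)
    then show ?thesis by (simp add: n_def power_mult)
  qed
  \<comment> \<open>33 is the largest integer whose product with 1936 stays below 65536. Its powers
    overtake the constant \<open>2 * 44 ^ k\<close>; passing to \<open>Suc l\<close> meets the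
    hypothesis \<open>0 < l\<close> of \<open>bound\<close>.\<close>
  obtain l :: nat where l: "2 * 44 ^ k < (33 :: real) ^ l"
    using real_arch_pow[of 33 "2 * 44 ^ k"] by auto
  have "65536 ^ Suc l \<le> 2 * (44 ^ (k + Suc l) * 44 ^ Suc l :: real)" by (rule bound) simp
  also have "\<dots> = 2 * 44 ^ k * 1936 ^ Suc l"
    by (simp add: power_add flip: power_mult_distrib)
  also have "\<dots> < 33 ^ Suc l * 1936 ^ Suc l"
    by (intro mult_strict_right_mono less_le_trans[OF l] power_increasing) auto
  also have "\<dots> = 63888 ^ Suc l" by (simp only: flip: power_mult_distrib) simp
  also have "\<dots> \<le> 65536 ^ Suc l" by (rule power_mono) auto
  finally show False by simp
qed

theorem proposition7:
  shows "\<exists>(M1 :: point measure) (T1 :: point \<Rightarrow> point) (M2 :: point measure) (T2 :: point \<Rightarrow> point).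
           standard_borel M1 \<and> prob_space M1 \<and> automorphism M1 T1 \<and> ergodic M1 T1 \<and>
           standard_borel M2 \<and> prob_space M2 \<and> automorphism M2 T2 \<and> ergodic M2 T2 \<and>
           markov_quasi_similar M1 T1 M2 T2 \<and>
           \<not> weakly_isomorphic M1 T1 M2 T2"
proof (intro exI conjI)
  \<comment> \<open>The noise parameter 31/63 is the solution \<open>d\<close> of 1/64 + d - d/64 =
    1/2.\<close>
  show "markov_quasi_similar (bern_seq (1 / 64)) (coord_shift 1) (bern_seq (1 / 2)) (coord_shift 1)"
    using markov_quasi_image_thin[of "1 / 2" "1 / 32" 1] markov_quasi_image_thicken[of "1 / 64" "31 / 63" 1]
    by (simp add: markov_quasi_similar_def)
  show "\<not> weakly_isomorphic (bern_seq (1 / 64)) (coord_shift 1) (bern_seq (1 / 2)) (coord_shift 1)"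
    using not_factor_of_fair by (simp add: weakly_isomorphic_def)
qed (rule standard_borel_bern_seq prob_space_bern_seq automorphism_shift ergodic_shift)+

end
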